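(* Let $K$ be a field, $S=K[x_1,\dots,x_n]$ with $\mathfrak{m}=(x_1,\dots,x_n)$, let $I\subset S$ be a polymatroidal ideal and let $i\ge0$. If $\mathfrak{m}\in\mathrm{Ass}\,\mathrm{HS}_i(I^{k_0})$ for some $k_0>0$, then $\mathfrak{m}\in\mathrm{Ass}\,\mathrm{HS}_i(I^k)$ for all $k\ge k_0$.
   Context: $S$ carries its standard $\mathbb{Z}^n$-grading. For a monomial ideal $J$, $\mathcal{G}(J)$ denotes its minimal set of monomial generators, and $\deg_{x_i}(u)$ is the exponent of $x_i$ in the monomial $u$. For $i\ge0$, $\mathrm{HS}_i(J)=(\mathbf{x}^{\mathbf a}:\ \mathrm{Tor}_i^S(K,J)_{\mathbf a}\neq0)$, where $\mathbf{x}^{\mathbf a}=x_1^{a_1}\cdots x_n^{a_n}$ (the zero ideal if $\mathrm{Tor}_i^S(K,J)=0$). For an ideal $L\subset S$, $\mathrm{Ass}\,L$ denotes the set of associated primes of $S/L$. A nonzero monomial ideal $I$ is polymatroidal if all elements of $\mathcal{G}(I)$ have the same degree and: for all $u,v\in\mathcal{G}(I)$ and all $i$ with $\deg_{x_i}(u)>\deg_{x_i}(v)$, there is $j$ with $\deg_{x_j}(u)<\deg_{x_j}(v)$ such that $x_j(u/x_i)\in\mathcal{G}(I)$. *)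

theory Defs
  imports "HOL-Library.Poly_Mapping" "Jordan_Normal_Form.Matrix_Kernel"
begin

(* The variables x_v of S = K[x_1,...,x_n] are indexed by the elements v of a finite type 'n.
   An exponent vector is a map 'n \<Rightarrow>\<^sub>0 nat, a multidegree a map 'n \<Rightarrow>\<^sub>0 int. *)

type_synonym ('n, 'k) mpoly = "('n \<Rightarrow>\<^sub>0 nat) \<Rightarrow>\<^sub>0 'k"

definition monomial :: "('n \<Rightarrow>\<^sub>0 nat) \<Rightarrow> ('n, 'k::comm_ring_1) mpoly" where
  "monomial a = Poly_Mapping.single a 1"

definition multideg :: "('n \<Rightarrow>\<^sub>0 nat) \<Rightarrow> ('n \<Rightarrow>\<^sub>0 int)" where
  "multideg a = Poly_Mapping.map int a"

definition homogeneous :: "('n \<Rightarrow>\<^sub>0 int) \<Rightarrow> ('n, 'k::comm_ring_1) mpoly \<Rightarrow> bool" where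
  "homogeneous a f \<longleftrightarrow> (\<forall>m \<in> Poly_Mapping.keys f. multideg m = a)"

(* Ideals are the submodules of the ring regarded as a module over itself. *)

lemma module_times: "Modules.module ((*) :: 'a::comm_ring_1 \<Rightarrow> 'a \<Rightarrow> 'a)"
  by (simp add: Modules.module_def algebra_simps)

definition is_ideal :: "'a::comm_ring_1 set \<Rightarrow> bool" where
  "is_ideal J \<longleftrightarrow> Modules.module.subspace (*) J"

definition ideal_gen :: "'a::comm_ring_1 set \<Rightarrow> 'a set" where
  "ideal_gen A = Modules.module.span (*) A"

definition ideal_mult :: "'a::comm_ring_1 set \<Rightarrow> 'a set \<Rightarrow> 'a set" where
  "ideal_mult J L = ideal_gen {f * g | f g. f \<in> J \<and> g \<in> L}"

primrec ideal_power :: "'a::comm_ring_1 set \<Rightarrow> nat \<Rightarrow> 'a set" where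
  "ideal_power J 0 = UNIV"
| "ideal_power J (Suc k) = ideal_mult J (ideal_power J k)"

definition prime_ideal :: "'a::comm_ring_1 set \<Rightarrow> bool" where
  "prime_ideal P \<longleftrightarrow> is_ideal P \<and> P \<noteq> UNIV \<and> (\<forall>f g. f * g \<in> P \<longrightarrow> f \<in> P \<or> g \<in> P)"

(* {g. g * f \<in> L} is the annihilator of the residue class of f in S/L. *)

definition Ass :: "'a::comm_ring_1 set \<Rightarrow> 'a set set" where
  "Ass L = {P. prime_ideal P \<and> (\<exists>f. P = {g. g * f \<in> L})}"

definition graded_max_ideal :: "('n, 'k::comm_ring_1) mpoly set" where
  "graded_max_ideal = ideal_gen (range (\<lambda>v. monomial (Poly_Mapping.single v 1)))"

(* The monomials with exponent vectors in B are the minimal set of monomial generators of J.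
   Such a B exists exactly for monomial ideals J, and is then unique. *)

definition min_monomial_gens :: "('n, 'k::comm_ring_1) mpoly set \<Rightarrow> ('n \<Rightarrow>\<^sub>0 nat) set \<Rightarrow> bool" where
  "min_monomial_gens J B \<longleftrightarrow>
     ideal_gen (monomial ` B) = J \<and> (\<forall>C. C \<subset> B \<longrightarrow> ideal_gen (monomial ` C) \<noteq> J)"

definition total_deg :: "('n::finite \<Rightarrow>\<^sub>0 nat) \<Rightarrow> nat" where
  "total_deg a = (\<Sum>v\<in>UNIV. Poly_Mapping.lookup a v)"

definition polymatroidal :: "('n::finite, 'k::field) mpoly set \<Rightarrow> bool" where
  "polymatroidal I \<longleftrightarrow> I \<noteq> {0} \<and>
     (\<exists>B. min_monomial_gens I B \<and>
        (\<forall>u\<in>B. \<forall>w\<in>B. total_deg u = total_deg w) \<and>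
        (\<forall>u\<in>B. \<forall>w\<in>B. \<forall>i. Poly_Mapping.lookup u i > Poly_Mapping.lookup w i \<longrightarrow>
           (\<exists>j. Poly_Mapping.lookup u j < Poly_Mapping.lookup w j \<and>
              (u - Poly_Mapping.single i 1) + Poly_Mapping.single j 1 \<in> B)))"

(* The module K = S/(x_1,...,x_n): S acts through the constant coefficient, so the S-linear map
   from the free module with basis e_0, ..., e_(r-1) to K that sends e_q to c_q
   maps v to the sum of the c_q * v_q(0). *)

definition augmentation :: "'k vec \<Rightarrow> ('n, 'k::comm_ring_1) mpoly vec \<Rightarrow> 'k" where
  "augmentation c v = (\<Sum>q<dim_vec v. c $ q * Poly_Mapping.lookup (v $ q) 0)"

(* A multigraded free resolution ... \<rightarrow> F_1 \<rightarrow> F_0 \<rightarrow> K \<rightarrow> 0 with all F_p of finite rank.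
   The list s p holds the degrees of the homogeneous basis of F_p, so that F_p is the direct sum
   of the S(- s p ! q); the matrix D p is the differential F_(p+1) \<rightarrow> F_p; and c describes the
   augmentation F_0 \<rightarrow> K, where K lives in degree 0. *)

definition graded_free_resolution_K ::
    "(nat \<Rightarrow> ('n \<Rightarrow>\<^sub>0 int) list) \<Rightarrow> (nat \<Rightarrow> ('n, 'k::field) mpoly mat) \<Rightarrow> 'k vec \<Rightarrow> bool" where
  "graded_free_resolution_K s D c \<longleftrightarrow>
     (\<forall>p. D p \<in> carrier_mat (length (s p)) (length (s (Suc p)))) \<and>
     (\<forall>p. \<forall>q < length (s p). \<forall>r < length (s (Suc p)).
        homogeneous (s (Suc p) ! r - s p ! q) (D p $$ (q, r))) \<and>
     c \<in> carrier_vec (length (s 0)) \<and>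
     (\<forall>q < length (s 0). c $ q \<noteq> 0 \<longrightarrow> s 0 ! q = 0) \<and>
     augmentation c ` (carrier_vec (length (s 0)) :: ('n, 'k) mpoly vec set) = UNIV \<and>
     {v \<in> carrier_vec (length (s 0)). augmentation c v = 0}
       = (\<lambda>w. D 0 *\<^sub>v w) ` carrier_vec (length (s 1)) \<and>
     (\<forall>p. mat_kernel (D p) = (\<lambda>w. D (Suc p) *\<^sub>v w) ` carrier_vec (length (s (Suc (Suc p)))))"

(* The component of degree a of F \<otimes> J, for F the free module with basis degrees ds and J an ideal:
   F \<otimes> J is identified with the vectors over J. *)

definition tensor_ideal_component ::
    "('n \<Rightarrow>\<^sub>0 int) list \<Rightarrow> ('n, 'k::field) mpoly set \<Rightarrow> ('n \<Rightarrow>\<^sub>0 int) \<Rightarrow> ('n, 'k) mpoly vec set" where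
  "tensor_ideal_component ds J a =
     {v \<in> carrier_vec (length ds). \<forall>q < length ds. v $ q \<in> J \<and> homogeneous (a - ds ! q) (v $ q)}"

definition Tor_cycles ::
    "(nat \<Rightarrow> ('n \<Rightarrow>\<^sub>0 int) list) \<Rightarrow> (nat \<Rightarrow> ('n, 'k::field) mpoly mat) \<Rightarrow>
     nat \<Rightarrow> ('n, 'k) mpoly set \<Rightarrow> ('n \<Rightarrow>\<^sub>0 int) \<Rightarrow> ('n, 'k) mpoly vec set" where
  "Tor_cycles s D i J a = {z \<in> tensor_ideal_component (s i) J a.
     case i of 0 \<Rightarrow> True | Suc p \<Rightarrow> z \<in> mat_kernel (D p)}"

definition Tor_boundaries ::
    "(nat \<Rightarrow> ('n \<Rightarrow>\<^sub>0 int) list) \<Rightarrow> (nat \<Rightarrow> ('n, 'k::field) mpoly mat) \<Rightarrow>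
     nat \<Rightarrow> ('n, 'k) mpoly set \<Rightarrow> ('n \<Rightarrow>\<^sub>0 int) \<Rightarrow> ('n, 'k) mpoly vec set" where
  "Tor_boundaries s D i J a = (\<lambda>w. D i *\<^sub>v w) ` tensor_ideal_component (s (Suc i)) J a"

(* Tor_i(K, J) is nonzero in degree a. Tor does not depend on the resolution F of K, hence
   "some resolution" and "every resolution" mean the same here. *)

definition Tor_nonzero ::
    "nat \<Rightarrow> ('n::finite, 'k::field) mpoly set \<Rightarrow> ('n \<Rightarrow>\<^sub>0 int) \<Rightarrow> bool" where
  "Tor_nonzero i J a \<longleftrightarrow>
     (\<exists>s D (c :: 'k vec). graded_free_resolution_K s D c \<and>
        Tor_cycles s D i J a \<noteq> Tor_boundaries s D i J a)"

(* Only degrees in \<nat>^n occur: Tor_i(K, J) vanishes in all other degrees. *)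

definition HS :: "nat \<Rightarrow> ('n::finite, 'k::field) mpoly set \<Rightarrow> ('n, 'k) mpoly set" where
  "HS i J = ideal_gen (monomial ` {a. Tor_nonzero i J (multideg a)})"

end

theory Submission
  imports Defs "HOL-Library.Function_Algebras"
begin

text \<open>
  Let B be the set of exponent vectors of the minimal generators of a power of I; it is again
  M-convex, i.e. the set of bases of a discrete polymatroid.  Ordering B lexicographically gives
  linear quotients, and Mayer-Vietoris arguments along this order show, for any multigraded free
  resolution of K, that Tor_i is nonzero in degree a iff a lies in the set A_i(B) of those a for
  which there are sets F without common element such that |F| = i and a - 1_F is in B.  If rho is
  the rank function of B and d its degree, then A_i(B) consists of the a of degree d + i with
  a(S) <= rho(S) + min(i, |S| - 1) for all nonempty S.  The right-hand side is submodular on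
  intersecting pairs, so A_i(B) satisfies the exchange property, and therefore the maximal ideal is
  associated to HS_i iff there is a w with w + e_v in A_i(B) for all v.  Adding the exponent vector
  of a generator of I to w yields such a vector for the next power.
\<close>

section \<open>Exchange and rank functions\<close>

text \<open>Tor may be computed here from any multigraded resolution of K, minimal or not, and no
  particular one (such as the Koszul complex) is constructed. The only homological input is that the
  strand of the resolution in degree a has no homology except K for a = 0; the rest comes from
  Mayer-Vietoris sequences. Their maps need not be known, for reasons of total degree: Tor_i of the
  intersection and Tor_i of either summand are never both nonzero in the same multidegree, so
  nothing cancels. The bound min(i, |S| - 1) limits how much of S a set F of size i can cover if it
  has to miss an element of S. Exchange for A_i(B) is needed because a socle monomial of HS_i could
  a priori have degree above d + i - 1; exchange brings it down to that degree.\<close>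

definition swap :: "'n \<Rightarrow> 'n \<Rightarrow> ('n \<Rightarrow> int) \<Rightarrow> 'n \<Rightarrow> int" where
  "swap v j b = (\<lambda>x. b x - of_bool (x = v) + of_bool (x = j))"

definition exchange :: "('n \<Rightarrow> int) set \<Rightarrow> bool" where
  "exchange B \<longleftrightarrow> (\<forall>b\<in>B. \<forall>c\<in>B. \<forall>v. c v < b v \<longrightarrow> (\<exists>j. b j < c j \<and> swap v j b \<in> B))"

definition l1_dist :: "('n::finite \<Rightarrow> int) \<Rightarrow> ('n \<Rightarrow> int) \<Rightarrow> nat" where
  "l1_dist b c = (\<Sum>x\<in>UNIV. nat \<bar>b x - c x\<bar>)"

lemma swap_same [simp]: "swap v v b = b"
  by (simp add: swap_def)

lemma swap_swap: "swap v j (swap j l b) = swap v l b" "swap j l (swap v j b) = swap v l b"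
  by (auto simp: swap_def)

lemma sum_swap:
  "sum (swap v j b) S = sum b S - of_bool (v \<in> S) + of_bool (j \<in> S)" for S :: "'n::finite set"
  by (simp add: swap_def sum.distrib sum_subtractf of_bool_def)

lemma exchangeE:
  assumes "exchange B" "b \<in> B" "c \<in> B" "c v < b v"
  obtains j where "b j < c j" "swap v j b \<in> B"
  using assms unfolding exchange_def by blast

lemma l1_dist_swap: "l1_dist (swap v j b) c < l1_dist b c" if "c v < b v" "b j < c j"
  unfolding l1_dist_def
proof (rule sum_strict_mono_ex1)
  show "\<forall>x\<in>UNIV. nat \<bar>swap v j b x - c x\<bar> \<le> nat \<bar>b x - c x\<bar>"
    using that by (auto simp: swap_def)
  show "\<exists>x\<in>UNIV. nat \<bar>swap v j b x - c x\<bar> < nat \<bar>b x - c x\<bar>"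
    using that by (intro bexI[of _ v]) (auto simp: swap_def)
qed simp

lemma sum_less_ex:
  fixes b c :: "'n \<Rightarrow> int"
  assumes "sum b S < sum c S" shows "\<exists>x\<in>S. b x < c x"
  using assms by (meson not_less sum_mono)

lemma sum_Compl: "sum b S + sum b (- S) = sum b UNIV" for b :: "'n::finite \<Rightarrow> int"
  using sum.subset_diff[of S UNIV b] by (simp add: Compl_eq_Diff_UNIV)

locale m_convex =
  fixes B :: "('n::finite \<Rightarrow> int) set" and d :: int
  assumes fin: "finite B" and nonempty: "B \<noteq> {}"
    and degree: "b \<in> B \<Longrightarrow> sum b UNIV = d"
    and exch: "exchange B"
begin

text \<open>\<open>exchange\<close> prescribes the index at which b loses a unit; here the index
  that gains one is prescribed. Exchanges move c towards b and keep \<open>b v < c v\<close> until v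
  is the only index at which c exceeds b, by exactly 1. Equal degrees then leave one index j with a
  deficit of 1, so c itself is \<open>swap j v b\<close>.\<close>

lemma dual_exchange:
  assumes "b \<in> B" "c \<in> B" "b v < c v"
  shows "\<exists>j. c j < b j \<and> swap j v b \<in> B"
  using assms(2,3)
proof (induction "l1_dist c b" arbitrary: c rule: less_induct)
  case less
  show ?case
  proof (cases "\<exists>w. b w < c w \<and> (w \<noteq> v \<or> b v + 1 < c v)")
    case True
    then obtain w where w: "b w < c w" "w \<noteq> v \<or> b v + 1 < c v" by blast
    obtain j where j: "c j < b j" "swap w j c \<in> B"
      using exchangeE[OF exch \<open>c \<in> B\<close> assms(1) w(1)] by blast
    have "l1_dist (swap w j c) b < l1_dist c b" by (rule l1_dist_swap[OF w(1) j(1)])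
    moreover have "b v < swap w j c v" using w j(1) less.prems by (auto simp: swap_def)
    ultimately obtain j' where j': "swap w j c j' < b j'" "swap j' v b \<in> B"
      using less.hyps j(2) by blast
    then have "c j' < b j'" using w j(1) by (auto simp: swap_def of_bool_def split: if_splits)
    then show ?thesis using j' by blast
  next
    case False
    have cv: "c v = b v + 1"
    proof -
      have "\<not> b v + 1 < c v" using False less.prems by blast
      then show ?thesis using less.prems by linarith
    qed
    have le: "c x \<le> b x" if "x \<noteq> v" for x using False that by (meson not_less)
    have "(\<Sum>x\<in>UNIV. b x - c x) = 0"
      using degree[OF assms(1)] degree[OF \<open>c \<in> B\<close>] by (simp add: sum_subtractf)
    then have s1: "(\<Sum>x\<in>UNIV-{v}. b x - c x) = 1"
      using cv by (simp add: sum.remove[of _ v])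
    have "(\<Sum>x\<in>UNIV-{v}. b x - c x) \<le> 0" if "\<forall>x. x \<noteq> v \<longrightarrow> b x \<le> c x"
      using that by (intro sum_nonpos) auto
    then obtain j where j: "j \<noteq> v" "c j < b j" using s1 by force
    have s2: "(\<Sum>x\<in>UNIV-{v}-{j}. b x - c x) = 1 - (b j - c j)"
      using s1 j sum.remove[of "UNIV-{v}" j "\<lambda>x. b x - c x"] by simp
    moreover have "0 \<le> (\<Sum>x\<in>UNIV-{v}-{j}. b x - c x)" using le by (intro sum_nonneg) auto
    ultimately have bj: "b j = c j + 1" and "(\<Sum>x\<in>UNIV-{v}-{j}. b x - c x) = 0" using j by auto
    then have "\<forall>x\<in>UNIV-{v}-{j}. b x - c x = 0"
      using le by (subst (asm) sum_nonneg_eq_0_iff) auto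
    then have "swap j v b = c" using cv bj j by (auto simp: swap_def fun_eq_iff)
    then show ?thesis using j less.prems by auto
  qed
qed

text \<open>Exchange is applied to the two given vectors at index j. The only index at which
  \<open>swap t v b\<close> is smaller than \<open>swap j t b\<close> is t, so the exchange partner
  is forced.\<close>

lemma swap_trans:
  assumes "b \<in> B" "swap t v b \<in> B" "swap j t b \<in> B" shows "swap j v b \<in> B"
proof (cases "t = v \<or> t = j \<or> j = v")
  case False
  have "swap j t b j < swap t v b j" using False by (auto simp: swap_def)
  then obtain l where "swap t v b l < swap j t b l" "swap j l (swap t v b) \<in> B"
    using exchangeE[OF exch assms(2,3)] by blast
  moreover from this have "l = t" by (auto simp: swap_def of_bool_def split: if_splits)
  ultimately show ?thesis by (simp add: swap_swap)
qed (use assms in auto)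

section \<open>The rank function and its tight sets\<close>

definition rk :: "'n set \<Rightarrow> int" where
  "rk S = Max ((\<lambda>b. sum b S) ` B)"

lemma sum_le_rk: "b \<in> B \<Longrightarrow> sum b S \<le> rk S"
  unfolding rk_def using fin by simp

lemma rk_attained: "\<exists>b\<in>B. sum b S = rk S"
proof -
  have "rk S \<in> (\<lambda>b. sum b S) ` B" unfolding rk_def using fin nonempty by (intro Max_in) auto
  then show ?thesis by auto
qed

lemma rk_empty [simp]: "rk {} = 0"
  using rk_attained[of "{}"] by simp

text \<open>Nested sets have a common maximizer; submodularity rests on this for
  \<open>S \<inter> T\<close> and \<open>S \<union> T\<close>. A maximizer for X is moved towards
  one for Y. Units leave only indices outside Y, so the sum over X never drops.\<close>

lemma rk_attained2:
  assumes "X \<subseteq> Y" shows "\<exists>b\<in>B. sum b X = rk X \<and> sum b Y = rk Y"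
proof -
  have "\<exists>b\<in>B. sum b X = rk X \<and> sum b Y = rk Y"
    if "b \<in> B" "c \<in> B" "sum b X = rk X" "sum c Y = rk Y" for b c
    using that
  proof (induction "l1_dist b c" arbitrary: b rule: less_induct)
    case less
    show ?case
    proof (cases "sum b Y = rk Y")
      case False
      then have "sum b Y < sum c Y" using less.prems sum_le_rk[of b Y] by simp
      moreover have "sum b Y + sum b (-Y) = sum c Y + sum c (-Y)"
        using less.prems degree sum_Compl[of b Y] sum_Compl[of c Y] by simp
      ultimately have "sum c (-Y) < sum b (-Y)" by simp
      then obtain v where v: "v \<notin> Y" "c v < b v" using sum_less_ex by blast
      obtain j where j: "b j < c j" "swap v j b \<in> B"
        using exchangeE[OF exch less.prems(1,2) v(2)] by blast
      have "rk X \<le> sum (swap v j b) X" using v assms less.prems by (auto simp: sum_swap)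
      then have "sum (swap v j b) X = rk X" using sum_le_rk[OF j(2), of X] by simp
      then show ?thesis using less.hyps[OF l1_dist_swap[OF v(2) j(1)] j(2)] less.prems by blast
    qed (use less.prems in auto)
  qed
  then show ?thesis using rk_attained by metis
qed

lemma sum_Un_Int_int: "sum b (S \<union> T) + sum b (S \<inter> T) = sum b S + sum b T" for b :: "'n \<Rightarrow> int"
  by (simp add: sum.union_inter)

lemma rk_submodular: "rk (S \<union> T) + rk (S \<inter> T) \<le> rk S + rk T"
proof -
  obtain b where b: "b \<in> B" "sum b (S \<inter> T) = rk (S \<inter> T)" "sum b (S \<union> T) = rk (S \<union> T)"
    using rk_attained2[of "S \<inter> T" "S \<union> T"] by auto
  then show ?thesis
    using sum_Un_Int_int[of b S T] sum_le_rk[OF b(1), of S] sum_le_rk[OF b(1), of T] by linarith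
qed

lemma tight_Un:
  assumes "b \<in> B" "sum b S = rk S" "sum b T = rk T" shows "sum b (S \<union> T) = rk (S \<union> T)"
  using sum_Un_Int_int[of b S T] rk_submodular[of S T] assms
    sum_le_rk[OF assms(1), of "S \<union> T"] sum_le_rk[OF assms(1), of "S \<inter> T"] by linarith

text \<open>The indices that can pass a unit to v form the dependence set T of v at b. If c had a
  larger sum over T, \<open>dual_exchange\<close> and \<open>swap_trans\<close> would give j \<in> T
  with \<open>c j < b j\<close>; raising c at j brings it closer to b without lowering its sum over
  T, against the induction hypothesis.\<close>

lemma tight_in:
  assumes b: "b \<in> B" shows "sum b {j. swap j v b \<in> B} = rk {j. swap j v b \<in> B}"
proof -
  define T where "T = {j. swap j v b \<in> B}"
  have "sum c T \<le> sum b T" if "c \<in> B" for c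
    using that
  proof (induction "l1_dist c b" arbitrary: c rule: less_induct)
    case less
    show ?case
    proof (rule ccontr)
      assume *: "\<not> ?thesis"
      then obtain t where t: "t \<in> T" "b t < c t" using sum_less_ex[of b T c] by auto
      obtain j where j: "c j < b j" "swap j t b \<in> B" using dual_exchange[OF b less.prems t(2)] by blast
      have "j \<in> T" using swap_trans[OF b _ j(2)] t(1) by (simp add: T_def)
      obtain l where l: "b l < c l" "swap l j c \<in> B" using dual_exchange[OF less.prems b j(1)] by blast
      have "sum (swap l j c) T \<le> sum b T" using less.hyps[OF l1_dist_swap[OF l(1) j(1)] l(2)] .
      then show False using * \<open>j \<in> T\<close> by (auto simp: sum_swap of_bool_def split: if_splits)
    qed
  qed
  moreover have "sum b T \<le> rk T" by (rule sum_le_rk[OF b])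
  ultimately have "sum b T = rk T" using rk_attained[of T] by (metis order_antisym)
  then show ?thesis by (simp add: T_def)
qed

text \<open>By \<open>swap_trans\<close> the set contains, with each j, the dependence set of j. It
  is thus a union of tight sets, and tight sets are closed under union.\<close>

lemma tight_out:
  assumes b: "b \<in> B" shows "sum b {j. swap v j b \<notin> B} = rk {j. swap v j b \<notin> B}"
proof -
  have "sum b (\<Union>j\<in>S. {l. swap l j b \<in> B}) = rk (\<Union>j\<in>S. {l. swap l j b \<in> B})" for S
  proof -
    have "finite S" by simp
    then show ?thesis
      by (induction S rule: finite_induct) (auto intro: tight_Un tight_in b)
  qed
  moreover have "(\<Union>j\<in>{j. swap v j b \<notin> B}. {l. swap l j b \<in> B}) = {j. swap v j b \<notin> B}" (is "?L = ?R")
  proof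
    show "?R \<subseteq> ?L" using b by auto
    show "?L \<subseteq> ?R" using swap_trans[OF b] by blast
  qed
  ultimately show ?thesis by metis
qed

text \<open>An integral box theorem for base polytopes, in which lower and upper bounds are tested
  separately against \<open>rk\<close>. \<Phi> is the l1 distance to the box; if no swap at a
  violating index v decreases it, the tight set from \<open>tight_out\<close> or
  \<open>tight_in\<close> contradicts the corresponding bound.\<close>

lemma box_meets:
  assumes "lo \<le> hi" and lo: "\<And>S. sum lo S \<le> rk S" and hi: "\<And>S. d - rk (- S) \<le> sum hi S"
  shows "\<exists>b\<in>B. lo \<le> b \<and> b \<le> hi"
proof -
  define \<Phi> where "\<Phi> b = (\<Sum>x\<in>UNIV. nat (b x - hi x) + nat (lo x - b x))" for b
  have \<Phi>: "\<Phi> (swap v j b) < \<Phi> b"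
    if "(hi v < b v \<and> b j < hi j) \<or> (lo v < b v \<and> b j < lo j)" for b v j
    unfolding \<Phi>_def
  proof (rule sum_strict_mono_ex1)
    have le: "lo x \<le> hi x" for x using assms(1) by (simp add: le_fun_def)
    show "\<forall>x\<in>UNIV. nat (swap v j b x - hi x) + nat (lo x - swap v j b x)
        \<le> nat (b x - hi x) + nat (lo x - b x)"
      using that le[of v] le[of j] by (auto simp: swap_def)
    show "\<exists>x\<in>UNIV. nat (swap v j b x - hi x) + nat (lo x - swap v j b x)
        < nat (b x - hi x) + nat (lo x - b x)"
      using that
    proof
      assume "hi v < b v \<and> b j < hi j"
      then show ?thesis using le[of v] le[of j] by (intro bexI[of _ v]) (auto simp: swap_def)
    next
      assume "lo v < b v \<and> b j < lo j"
      then show ?thesis using le[of v] le[of j] by (intro bexI[of _ j]) (auto simp: swap_def)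
    qed
  qed simp
  have "\<exists>b\<in>B. lo \<le> b \<and> b \<le> hi" if "b \<in> B" for b
    using that
  proof (induction "\<Phi> b" arbitrary: b rule: less_induct)
    case less
    consider v where "hi v < b v" | v where "b v < lo v" | "lo \<le> b" "b \<le> hi"
      unfolding le_fun_def by (meson not_less)
    then show ?case
    proof cases
      case 1
      have "\<exists>j. b j < hi j \<and> swap v j b \<in> B"
      proof (rule ccontr)
        assume *: "\<not> ?thesis"
        define S where "S = {j. swap v j b \<notin> B}"
        have "sum hi (-S) < sum b (-S)"
          using * 1 less.prems by (intro sum_strict_mono_ex1) (auto simp: S_def not_less)
        moreover have "sum b S + sum b (-S) = d"
          using degree[OF less.prems] by (simp add: sum_Compl)
        ultimately show False using hi[of "-S"] tight_out[OF less.prems, of v] by (simp add: S_def)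
      qed
      then obtain j where "b j < hi j" "swap v j b \<in> B" by blast
      then show ?thesis using less.hyps[OF \<Phi>] 1 by blast
    next
      case 2
      have "\<exists>j. lo j < b j \<and> swap j v b \<in> B"
      proof (rule ccontr)
        assume *: "\<not> ?thesis"
        define T where "T = {j. swap j v b \<in> B}"
        have "sum b T < sum lo T"
          using * 2 less.prems
          by (intro sum_strict_mono_ex1) (auto simp: T_def not_less intro!: exI[of _ v])
        then show False using lo[of T] tight_in[OF less.prems, of v] by (simp add: T_def)
      qed
      then obtain j where "lo j < b j" "swap j v b \<in> B" by blast
      then show ?thesis using less.hyps[OF \<Phi>] 2 by blast
    qed (use less.prems in auto)
  qed
  then show ?thesis using nonempty by blast
qed

end

text \<open>
  The quantification over v says that the matroid with bases F, where |F| = i and a - 1_F is in B,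
  exists and has no coloop.
\<close>

definition hs_set :: "nat \<Rightarrow> ('n \<Rightarrow> int) set \<Rightarrow> ('n \<Rightarrow> int) set" where
  "hs_set i B = {a. \<forall>v. \<exists>F. card F = i \<and> v \<notin> F \<and> (\<lambda>x. a x - of_bool (x \<in> F)) \<in> B}"

context m_convex begin

text \<open>The correction term bounds \<open>card (S \<inter> F)\<close> for F of size i missing an
  element of S. At the empty set the value is -1 while the sum is 0, so only nonempty sets serve as
  constraints and tight sets can be uncrossed only if they intersect.\<close>

definition hs_rk :: "nat \<Rightarrow> 'n set \<Rightarrow> int" where
  "hs_rk i S = rk S + min (int i) (int (card S) - 1)"

text \<open>Cardinality is modular and \<open>min i (c - 1)\<close> is concave in c, so the
  correction term is submodular as well.\<close>

lemma hs_rk_submodular: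
  assumes "S \<inter> T \<noteq> {}"
  shows "hs_rk i (S \<union> T) + hs_rk i (S \<inter> T) \<le> hs_rk i S + hs_rk i T"
proof -
  have "int (card (S \<union> T)) + int (card (S \<inter> T)) = int (card S) + int (card T)"
    using card_Un_Int[of S T] by simp
  moreover have "card (S \<inter> T) \<le> card S" "card (S \<inter> T) \<le> card T" by (auto intro: card_mono)
  ultimately show ?thesis using rk_submodular[of S T] by (simp add: hs_rk_def)
qed

lemma sum_minus_set: "(\<Sum>x\<in>S. a x - of_bool (x \<in> F)) = sum a S - int (card (S \<inter> F))" for a :: "'n \<Rightarrow> int"
  by (simp add: sum_subtractf)

text \<open>For fixed v, the admissible F correspond to the points of B in the box from a minus the
  indicator of \<open>- {v}\<close> up to a; the degree yields the size of F. In
  \<open>box_meets\<close> the lower bounds use the term \<open>card S - 1\<close> of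
  \<open>hs_rk\<close>, and the upper bounds, read on complements, use the term i.\<close>

lemma hs_set_iff:
  "a \<in> hs_set i B \<longleftrightarrow> sum a UNIV = d + int i \<and> (\<forall>S. S \<noteq> {} \<longrightarrow> sum a S \<le> hs_rk i S)"
proof (intro iffI conjI allI impI)
  assume a: "a \<in> hs_set i B"
  show "sum a UNIV = d + int i"
  proof -
    obtain F where "card F = i" "(\<lambda>x. a x - of_bool (x \<in> F)) \<in> B" using a by (auto simp: hs_set_def)
    then show ?thesis using degree sum_minus_set[of a F UNIV] by force
  qed
next
  fix S :: "'n set" assume a: "a \<in> hs_set i B" and "S \<noteq> {}"
  then obtain v where "v \<in> S" by blast
  obtain F where F: "card F = i" "v \<notin> F" "(\<lambda>x. a x - of_bool (x \<in> F)) \<in> B"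
    using a by (auto simp: hs_set_def)
  have "card (S \<inter> F) \<le> card (S - {v})" "card (S \<inter> F) \<le> i"
    using F by (auto intro!: card_mono)
  moreover have "card (S - {v}) = card S - 1" "card S > 0" using \<open>v \<in> S\<close> by (auto simp: card_gt_0_iff)
  ultimately show "sum a S \<le> hs_rk i S"
    using sum_le_rk[OF F(3), of S] by (simp add: sum_minus_set hs_rk_def)
next
  assume "sum a UNIV = d + int i \<and> (\<forall>S. S \<noteq> {} \<longrightarrow> sum a S \<le> hs_rk i S)"
  then have deg: "sum a UNIV = d + int i" and S: "\<And>S. S \<noteq> {} \<Longrightarrow> sum a S \<le> hs_rk i S" by blast+
  show "a \<in> hs_set i B"
    unfolding hs_set_def
  proof (intro CollectI allI)
    fix v
    have "\<exists>b\<in>B. (\<lambda>x. a x - of_bool (x \<in> - {v})) \<le> b \<and> b \<le> a"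
    proof (rule box_meets)
      show "(\<lambda>x. a x - of_bool (x \<in> - {v})) \<le> a" by (simp add: le_fun_def)
      show "(\<Sum>x\<in>S. a x - of_bool (x \<in> - {v})) \<le> rk S" for S
      proof (cases "S = {}")
        case False
        have "sum a S \<le> rk S + (int (card S) - 1)" using S[OF False] by (simp add: hs_rk_def)
        moreover have "card S - 1 \<le> card (S \<inter> - {v})"
          by (simp add: Diff_eq[symmetric] card_Diff_singleton_if)
        moreover have "card S > 0" using False by (simp add: card_gt_0_iff)
        ultimately show ?thesis unfolding sum_minus_set by linarith
      qed simp
      show "d - rk (- S) \<le> sum a S" for S
      proof -
        have "sum a S + sum a (-S) = d + int i"
          using deg by (simp add: sum_Compl)
        moreover have "sum a (-S) \<le> rk (-S) + int i"
        proof (cases "- S = {}")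
          case False
          show ?thesis using S[OF False] by (simp add: hs_rk_def)
        next
          case True
          show ?thesis unfolding True by simp
        qed
        ultimately show ?thesis by simp
      qed
    qed
    then obtain b where b: "b \<in> B" "\<And>x. a x - of_bool (x \<noteq> v) \<le> b x" "\<And>x. b x \<le> a x"
      by (auto simp: le_fun_def)
    define F where "F = {x. b x \<noteq> a x}"
    have bF: "b = (\<lambda>x. a x - of_bool (x \<in> F))" and "v \<notin> F"
    proof -
      have "b x = a x \<or> b x = a x - 1 \<and> x \<noteq> v" for x
        using b(2,3)[of x] by (cases "x = v") auto
      then show "b = (\<lambda>x. a x - of_bool (x \<in> F))" "v \<notin> F" by (auto simp: F_def fun_eq_iff)
    qed
    moreover have "card F = i" using degree[OF b(1)] deg bF sum_minus_set[of a F UNIV] by simp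
    ultimately show "\<exists>F. card F = i \<and> v \<notin> F \<and> (\<lambda>x. a x - of_bool (x \<in> F)) \<in> B" using b(1) by blast
  qed
qed

text \<open>Uncrossing: if no j works, each index where a' exceeds a lies in a tight set avoiding v.
  Intersecting tight sets have tight unions, so the maximal ones are disjoint. The sum of a' cannot
  exceed that of a on their union, nor a' exceed a at an index outside, and a' is smaller at v,
  against equal degrees.\<close>

lemma exchange_hs_set: "exchange (hs_set i B)"
  unfolding exchange_def
proof (intro ballI allI impI)
  fix a a' v assume a: "a \<in> hs_set i B" and a': "a' \<in> hs_set i B" and v: "a' v < a v"
  show "\<exists>j. a j < a' j \<and> swap v j a \<in> hs_set i B"
  proof (rule ccontr)
    assume *: "\<not> ?thesis"
    define \<T> where "\<T> = {S. S \<noteq> {} \<and> v \<notin> S \<and> sum a S = hs_rk i S}"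
    have cover: "\<exists>S\<in>\<T>. j \<in> S" if "a j < a' j" for j
    proof -
      have "swap v j a \<notin> hs_set i B" using * that by blast
      moreover have "sum (swap v j a) UNIV = d + int i" using a by (simp add: hs_set_iff sum_swap)
      ultimately obtain S where S: "S \<noteq> {}" "hs_rk i S < sum (swap v j a) S"
        unfolding hs_set_iff not_le[symmetric] by blast
      moreover have "sum a S \<le> hs_rk i S" using a S by (simp add: hs_set_iff)
      ultimately show ?thesis
        by (intro bexI[of _ S]) (auto simp: \<T>_def sum_swap of_bool_def split: if_splits)
    qed
    have Un: "S \<union> T \<in> \<T>" if "S \<in> \<T>" "T \<in> \<T>" "S \<inter> T \<noteq> {}" for S T
    proof -
      have "sum a (S \<union> T) \<le> hs_rk i (S \<union> T)" "sum a (S \<inter> T) \<le> hs_rk i (S \<inter> T)"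
        using a that by (auto simp: hs_set_iff)
      then have "sum a (S \<union> T) = hs_rk i (S \<union> T)"
        using hs_rk_submodular[OF that(3), of i] that sum_Un_Int_int[of a S T] by (auto simp: \<T>_def)
      then show ?thesis using that by (auto simp: \<T>_def)
    qed
    define \<M> where "\<M> = {S\<in>\<T>. \<forall>T\<in>\<T>. S \<subseteq> T \<longrightarrow> T = S}"
    have disj: "S \<inter> T = {}" if "S \<in> \<M>" "T \<in> \<M>" "S \<noteq> T" for S T
    proof (rule ccontr)
      assume "S \<inter> T \<noteq> {}"
      then have "S \<union> T \<in> \<T>" using Un that by (simp add: \<M>_def)
      moreover have "S \<union> T = S" if "S \<union> T \<in> \<T>" using \<open>S \<in> \<M>\<close> that by (simp add: \<M>_def)
      moreover have "S \<union> T = T" if "S \<union> T \<in> \<T>" using \<open>T \<in> \<M>\<close> that by (simp add: \<M>_def)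
      ultimately show False using \<open>S \<noteq> T\<close> by blast
    qed
    have fin_M: "\<forall>S\<in>\<M>. finite S" by simp
    have disj_M: "\<forall>S\<in>\<M>. \<forall>T\<in>\<M>. S \<noteq> T \<longrightarrow> S \<inter> T = {}"
      by (intro ballI impI disj)
    note sum_M = sum.Union_disjoint[OF fin_M disj_M, unfolded comp_def]
    have "sum a' (\<Union>\<M>) \<le> sum a (\<Union>\<M>)"
      unfolding sum_M 
    proof (rule sum_mono)
      fix S assume "S \<in> \<M>"
      then have "S \<noteq> {}" "sum a S = hs_rk i S" by (simp_all add: \<M>_def \<T>_def)
      then show "sum a' S \<le> sum a S" using a' by (simp add: hs_set_iff)
    qed
    moreover have "sum a' (- \<Union>\<M>) < sum a (- \<Union>\<M>)"
    proof (rule sum_strict_mono_ex1)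
      show "\<exists>x\<in>- \<Union>\<M>. a' x < a x" using v by (intro bexI[of _ v]) (auto simp: \<M>_def \<T>_def)
      show "\<forall>x\<in>- \<Union>\<M>. a' x \<le> a x"
      proof (intro ballI, rule ccontr)
        fix x assume x: "x \<in> - \<Union>\<M>" "\<not> a' x \<le> a x"
        then obtain S where S: "S \<in> \<T>" "x \<in> S" using cover[of x] by auto
        have "finite \<T>" by simp
        then obtain M where "M \<in> \<T>" "S \<subseteq> M" "\<forall>T\<in>\<T>. M \<subseteq> T \<longrightarrow> M = T"
          using finite_has_maximal2[of \<T> S] S by metis
        then have "M \<in> \<M>" by (auto simp: \<M>_def)
        then show False using x \<open>S \<subseteq> M\<close> S by blast
      qed
    qed simp
    moreover have "sum f (\<Union>\<M>) + sum f (- \<Union>\<M>) = sum f UNIV" for f :: "'n \<Rightarrow> int"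
      by (simp add: sum_Compl)
    from this[of a] this[of a'] have "sum a (\<Union>\<M>) + sum a (- \<Union>\<M>) = sum a' (\<Union>\<M>) + sum a' (- \<Union>\<M>)"
      using a a' by (simp add: hs_set_iff)
    ultimately show False by simp
  qed
qed

end

text \<open>
  An exchange in one summand changes the sum at v as desired but may create an excess at another
  index j; the excess is then passed on from j, and the summands have moved closer to the target.
\<close>

lemma exchange_sumset:
  fixes B C :: "('n::finite \<Rightarrow> int) set"
  assumes "exchange B" "exchange C"
  shows "exchange {\<lambda>x. b x + c x | b c. b \<in> B \<and> c \<in> C}"
proof -
  let ?D = "{\<lambda>x. b x + c x | b c. b \<in> B \<and> c \<in> C}"
  have "\<exists>j. b j + c j < b' j + c' j \<and> swap v j (\<lambda>x. b x + c x) \<in> ?D"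
    if "b \<in> B" "c \<in> C" "b' \<in> B" "c' \<in> C" "b' v + c' v < b v + c v" for b c b' c' v
    using that
  proof (induction "l1_dist b b' + l1_dist c c'" arbitrary: b c v rule: less_induct)
    case less
    have step: "\<exists>j. b j + c j < b' j + c' j \<and> swap v j (\<lambda>x. b x + c x) \<in> ?D"
      if nw: "b\<^sub>1 \<in> B" "c\<^sub>1 \<in> C" "l1_dist b\<^sub>1 b' + l1_dist c\<^sub>1 c' < l1_dist b b' + l1_dist c c'"
        and eq: "(\<lambda>x. b\<^sub>1 x + c\<^sub>1 x) = swap v j (\<lambda>x. b x + c x)" and "j \<noteq> v" for b\<^sub>1 c\<^sub>1 j
    proof (cases "b j + c j < b' j + c' j")
      case True
      moreover have "swap v j (\<lambda>x. b x + c x) \<in> ?D" unfolding eq[symmetric] using nw(1,2) by blast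
      ultimately show ?thesis by blast
    next
      case False
      have eq': "b\<^sub>1 x + c\<^sub>1 x = swap v j (\<lambda>x. b x + c x) x" for x using eq by (rule fun_cong)
      have "b' j + c' j < b\<^sub>1 j + c\<^sub>1 j" using False \<open>j \<noteq> v\<close> eq'[of j] by (simp add: swap_def)
      then obtain l where l: "b\<^sub>1 l + c\<^sub>1 l < b' l + c' l" "swap j l (\<lambda>x. b\<^sub>1 x + c\<^sub>1 x) \<in> ?D"
        using less.hyps[OF nw(3,1,2) less.prems(3,4)] by blast
      \<comment> \<open>The case \<open>l = v\<close> cannot occur: the sum at v exceeded its target
        by at least 1 and has lost only 1.\<close>
      have "b l + c l < b' l + c' l"
        using l(1) eq'[of l] less.prems(5) by (auto simp: swap_def of_bool_def split: if_splits)
      then show ?thesis using l(2) unfolding eq swap_swap by blast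
    qed
    show ?case
    proof (cases "b' v < b v")
      case True
      obtain j where j: "b j < b' j" "swap v j b \<in> B"
        using exchangeE[OF assms(1) less.prems(1,3) True] by blast
      show ?thesis
        by (rule step[of "swap v j b" c j]) (use True j less.prems l1_dist_swap[OF True j(1)] in \<open>auto simp: swap_def\<close>)
    next
      case False
      then have c: "c' v < c v" using less.prems by simp
      obtain j where j: "c j < c' j" "swap v j c \<in> C"
        using exchangeE[OF assms(2) less.prems(2,4) c] by blast
      show ?thesis
        by (rule step[of b "swap v j c" j]) (use c j less.prems l1_dist_swap[OF c j(1)] in \<open>auto simp: swap_def\<close>)
    qed
  qed
  then show ?thesis unfolding exchange_def by blast
qed

section \<open>Homology of multigraded complexes over order ideals\<close>

definition ind :: "'n set \<Rightarrow> 'n \<Rightarrow> int" where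
  "ind F = (\<lambda>x. of_bool (x \<in> F))"

definition above :: "('n \<Rightarrow> int) \<Rightarrow> ('n \<Rightarrow> int) set" where
  "above u = {m. u \<le> m}"

text \<open>The exponents of u times the ideal of the variables in V, which is what linear quotients
  produce as intersection with a principal ideal.\<close>

definition var_multiples :: "('n \<Rightarrow> int) \<Rightarrow> 'n set \<Rightarrow> ('n \<Rightarrow> int) set" where
  "var_multiples u V = {m. u \<le> m \<and> (\<exists>v\<in>V. u v < m v)}"

lemma add_ind_le_iff: "u + ind {v} \<le> m \<longleftrightarrow> u \<le> m \<and> u v < m v"
proof
  assume "u + ind {v} \<le> m"
  then have le: "u x + of_bool (x = v) \<le> m x" for x
    by (simp add: ind_def le_fun_def)
  have "u x \<le> m x" for x using le[of x] by (cases "x = v") simp_all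
  then show "u \<le> m \<and> u v < m v" using le[of v] by (simp add: le_fun_def)
next
  assume "u \<le> m \<and> u v < m v"
  then show "u + ind {v} \<le> m" by (simp add: ind_def le_fun_def of_bool_def)
qed
text \<open>Adjoining a variable adds one principal ideal. The intersection with it has the same
  shape, shifted by \<open>ind {v}\<close>, because x_v is regular modulo the variables in V. This
  drives the induction over V.\<close>

lemma var_multiples_insert:
  "var_multiples u (insert v V) = var_multiples u V \<union> above (u + ind {v})"
  "v \<notin> V \<Longrightarrow> var_multiples u V \<inter> above (u + ind {v}) = var_multiples (u + ind {v}) V"
proof -
  show "var_multiples u (insert v V) = var_multiples u V \<union> above (u + ind {v})"
    unfolding var_multiples_def above_def add_ind_le_iff by blast
next
  assume "v \<notin> V"
  then have "(\<exists>w\<in>V. (u + ind {v}) w < m w) \<longleftrightarrow> (\<exists>w\<in>V. u w < m w)" for m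
    by (intro bex_cong) (auto simp: ind_def)
  then show "var_multiples u V \<inter> above (u + ind {v}) = var_multiples (u + ind {v}) V"
    unfolding var_multiples_def above_def add_ind_le_iff by blast
qed

lemma ind_empty [simp]: "ind {} = 0"
  by (auto simp: ind_def)

lemma sum_ind [simp]: "(\<Sum>x\<in>UNIV. u x + ind F x) = sum u UNIV + int (card F)" for u :: "'n::finite \<Rightarrow> int"
  by (simp add: ind_def sum.distrib)

lemma ind_insert: "v \<notin> F \<Longrightarrow> ind (insert v F) = ind {v} + ind F"
  by (auto simp: ind_def fun_eq_iff)

lemma card_swap: "v \<in> F \<Longrightarrow> l \<notin> F \<Longrightarrow> card (insert l (F - {v})) = card F" for F :: "'n::finite set"
  by (metis DiffD1 card_Suc_Diff1 card_insert_disjoint finite)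

text \<open>
  Lexicographic order, where e ranks the variables and larger values of e come first.
\<close>

definition before :: "('n \<Rightarrow> nat) \<Rightarrow> ('n \<Rightarrow> int) \<Rightarrow> ('n \<Rightarrow> int) \<Rightarrow> bool" where
  "before e w u \<longleftrightarrow> (\<exists>v. u v < w v \<and> (\<forall>x. e v < e x \<longrightarrow> w x = u x))"

lemma before_total:
  fixes u :: "'n::finite \<Rightarrow> int"
  assumes "inj e" "u \<noteq> w" shows "before e w u \<or> before e u w"
proof -
  let ?D = "{x. u x \<noteq> w x}"
  have "?D \<noteq> {}" using assms(2) by auto
  then have "Max (e ` ?D) \<in> e ` ?D" by (intro Max_in) auto
  then obtain v where v: "u v \<noteq> w v" "e v = Max (e ` ?D)" by auto
  have "w x = u x" if "e v < e x" for x
  proof (rule ccontr)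
    assume "w x \<noteq> u x"
    then have "e x \<le> e v" unfolding v(2) by (intro Max_ge) auto
    then show False using that by simp
  qed
  moreover from this have "u x = w x" if "e v < e x" for x using that by simp
  ultimately show ?thesis using v(1) unfolding before_def by (meson linorder_neqE_linordered_idom)
qed

lemma before_trans:
  assumes "inj e" "before e t w" "before e w u" shows "before e t u"
proof -
  obtain x where x: "w x < t x" "\<And>y. e x < e y \<Longrightarrow> t y = w y" using assms(2) by (auto simp: before_def)
  obtain z where z: "u z < w z" "\<And>y. e z < e y \<Longrightarrow> w y = u y" using assms(3) by (auto simp: before_def)
  show ?thesis
  proof (cases "e x = e z")
    case True
    then have "x = z" using assms(1) by (simp add: inj_eq)
    then show ?thesis using x z unfolding before_def by (intro exI[of _ x]) auto
  next
    case False
    then consider "e x < e z" | "e z < e x" by linarith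
    then show ?thesis
    proof cases
      case 1
      then show ?thesis using x z unfolding before_def by (intro exI[of _ z]) auto
    next
      case 2
      then show ?thesis using x z unfolding before_def by (intro exI[of _ x]) auto
    qed
  qed
qed

lemma before_irrefl: "\<not> before e u u"
  by (auto simp: before_def)

lemma before_swap: "e l < e v \<Longrightarrow> before e (swap l v u) u"
  unfolding before_def by (intro exI[of _ v]) (auto simp: swap_def)

lemma last_exists:
  fixes L :: "('n::finite \<Rightarrow> int) set"
  assumes "inj e" "finite L" "L \<noteq> {}"
  shows "\<exists>u\<in>L. \<forall>w\<in>L. w \<noteq> u \<longrightarrow> before e w u \<and> \<not> before e u w"
proof -
  have "asymp_on L (before e)" "transp_on L (before e)"
    using before_trans[OF assms(1)] before_irrefl[of e] by (auto intro!: asymp_onI transp_onI)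
  then obtain u where "u \<in> L" "\<forall>w\<in>L. w \<noteq> u \<longrightarrow> \<not> before e u w"
    using Finite_Set.bex_max_element[of L "before e"] assms by metis
  then show ?thesis using before_total[OF assms(1)] by metis
qed

context m_convex begin

text \<open>
  The variables that generate the colon ideal of the generators before u by u.
\<close>

definition lead :: "('n \<Rightarrow> nat) \<Rightarrow> ('n \<Rightarrow> int) \<Rightarrow> 'n set" where
  "lead e u = {v. \<exists>l. e l < e v \<and> swap l v u \<in> B}"

text \<open>This gives linear quotients. At the leading index v where w and u differ,
  \<open>dual_exchange\<close> supplies l with \<open>w l < u l\<close>; since w and u agree at all
  higher ranks, l ranks below v.\<close>

lemma before_imp_lead:
  assumes "inj e" "u \<in> B" "w \<in> B" "before e w u"
  shows "\<exists>v\<in>lead e u. u v < w v"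
proof -
  obtain v where v: "u v < w v" "\<And>x. e v < e x \<Longrightarrow> w x = u x" using assms(4) by (auto simp: before_def)
  obtain l where l: "w l < u l" "swap l v u \<in> B" using dual_exchange[OF assms(2,3) v(1)] by blast
  have "l \<noteq> v" using l v by auto
  moreover have "\<not> e v < e l" using l v(2)[of l] by auto
  ultimately have "e l < e v" using assms(1) by (metis inj_eq linorder_neqE_nat)
  then show ?thesis using l v by (auto simp: lead_def)
qed

text \<open>A degree a may be a generator plus an indicator in several ways; the lexicographically
  last one has \<open>F \<subseteq> lead e u\<close>. Conversely, each v in such an F can be traded
  for an index outside F, which yields the sets that miss v.\<close>

lemma hs_set_iff_lead:
  assumes "inj e"
  shows "a \<in> hs_set i B \<longleftrightarrow> (\<exists>u\<in>B. \<exists>F\<subseteq>lead e u. card F = i \<and> a = u + ind F)"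
proof
  assume "\<exists>u\<in>B. \<exists>F\<subseteq>lead e u. card F = i \<and> a = u + ind F"
  then obtain u F where u: "u \<in> B" and F: "F \<subseteq> lead e u" "card F = i" and a: "a = u + ind F" by blast
  show "a \<in> hs_set i B"
    unfolding hs_set_def
  proof (intro CollectI allI)
    fix v
    show "\<exists>F. card F = i \<and> v \<notin> F \<and> (\<lambda>x. a x - of_bool (x \<in> F)) \<in> B"
    proof (cases "v \<in> F")
      case False
      then show ?thesis using F u by (intro exI[of _ F]) (simp add: a ind_def)
    next
      case True
      let ?P = "\<lambda>l. e l < e v \<and> swap l v u \<in> B"
      \<comment> \<open>The least rank keeps l out of F: otherwise l would lie in
        \<open>lead e u\<close>, and by \<open>swap_trans\<close> its partner of smaller rank would
        also serve v.\<close>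
      obtain l where l: "?P l" and min: "\<And>l'. e l' < e l \<Longrightarrow> \<not> ?P l'"
        using True F ex_has_least_nat[of ?P _ e] unfolding lead_def
        by (smt (verit) mem_Collect_eq not_less subsetD)
      have "l \<notin> F"
      proof
        assume "l \<in> F"
        then obtain l' where l': "e l' < e l" "swap l' l u \<in> B" using F by (auto simp: lead_def)
        then have "swap l' v u \<in> B" using swap_trans[OF u] l by blast
        then show False using min[OF l'(1)] l l'(1) by auto
      qed
      have "card (insert l (F - {v})) = i" using card_swap[OF True \<open>l \<notin> F\<close>] F(2) by (simp only:)
      moreover have "(\<lambda>x. a x - of_bool (x \<in> insert l (F - {v}))) = swap l v u"
        using True \<open>l \<notin> F\<close> l by (auto simp: a ind_def swap_def fun_eq_iff)
      ultimately show ?thesis using l by (intro exI[of _ "insert l (F - {v})"]) auto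
    qed
  qed
next
  assume a: "a \<in> hs_set i B"
  define L where "L = {u\<in>B. \<exists>F. card F = i \<and> (\<lambda>x. a x - of_bool (x \<in> F)) = u}"
  have "finite L" using fin by (simp add: L_def)
  moreover have "L \<noteq> {}" using a unfolding hs_set_def L_def by blast
  ultimately obtain u where "u \<in> L"
    and last: "\<And>w. w \<in> L \<Longrightarrow> w \<noteq> u \<Longrightarrow> before e w u \<and> \<not> before e u w"
    using last_exists[OF assms, of L] by metis
  then obtain F where u: "u \<in> B" and F: "card F = i" "(\<lambda>x. a x - of_bool (x \<in> F)) = u"
    unfolding L_def by blast
  have ux: "u x = a x - of_bool (x \<in> F)" for x using F(2) by auto
  have "F \<subseteq> lead e u"
  proof
    fix v assume v: "v \<in> F"
    obtain F' where F': "card F' = i" "v \<notin> F'" "(\<lambda>x. a x - of_bool (x \<in> F')) \<in> B"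
      using a by (auto simp: hs_set_def)
    \<comment> \<open>Against a representation that omits v, u is too small at v, so some l can pass
      a unit to v. The result represents a with l in place of v in F; since u is last, l ranks below
      v.\<close>
    have "u v < a v - of_bool (v \<in> F')" using v F' by (simp add: ux)
    then obtain l where l: "a l - of_bool (l \<in> F') < u l" "swap l v u \<in> B"
      using dual_exchange[OF u F'(3)] by blast
    then have lF: "l \<notin> F" "l \<in> F'" by (auto simp: ux of_bool_def split: if_splits)
    then have "l \<noteq> v" using v by auto
    have "card (insert l (F - {v})) = i" using card_swap[OF v lF(1)] F(1) by (simp only:)
    moreover have eq: "(\<lambda>x. a x - of_bool (x \<in> insert l (F - {v}))) = swap l v u"
      by (rule ext) (use v lF in \<open>auto simp: swap_def ux\<close>)
    ultimately have "swap l v u \<in> L" using l unfolding L_def by blast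
    moreover have "swap l v u \<noteq> u" using \<open>l \<noteq> v\<close> by (auto simp: swap_def fun_eq_iff)
    ultimately have "\<not> before e u (swap l v u)" using last by blast
    moreover have "before e (swap v l (swap l v u)) (swap l v u)" if "e v < e l"
      by (rule before_swap) (rule that)
    ultimately have "\<not> e v < e l" by (auto simp: swap_swap)
    then have "e l < e v" using assms \<open>l \<noteq> v\<close> by (metis inj_eq linorder_neqE_nat)
    then show "v \<in> lead e u" using l by (auto simp: lead_def)
  qed
  moreover have "a = u + ind F" by (auto simp: fun_eq_iff ux ind_def)
  ultimately show "\<exists>u\<in>B. \<exists>F\<subseteq>lead e u. card F = i \<and> a = u + ind F" using u F(1) by blast
qed

end

text \<open>
  The degree-a component of F tensor J is spanned by the basis elements of F whose degree s
  satisfies a - s in J, so that it only depends on the scalar coefficients \<open>\<delta>\<close> of the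
  differential; \<open>\<sigma> p q\<close> is the degree of the q-th of the N p basis elements of F_p.
\<close>

locale multigraded_data =
  fixes N :: "nat \<Rightarrow> nat" and \<sigma> :: "nat \<Rightarrow> nat \<Rightarrow> 'n::finite \<Rightarrow> int"
    and \<delta> :: "nat \<Rightarrow> nat \<Rightarrow> nat \<Rightarrow> 'k::field"
begin

definition chain :: "nat \<Rightarrow> ('n \<Rightarrow> int) set \<Rightarrow> (nat \<Rightarrow> 'k) set" where
  "chain p U = {f. \<forall>q. f q \<noteq> 0 \<longrightarrow> q < N p \<and> \<sigma> p q \<in> U}"

definition diff :: "nat \<Rightarrow> (nat \<Rightarrow> 'k) \<Rightarrow> nat \<Rightarrow> 'k" where
  "diff p f = (\<lambda>q. if q < N p then \<Sum>r<N (Suc p). \<delta> p q r * f r else 0)"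

definition cycle :: "nat \<Rightarrow> ('n \<Rightarrow> int) set \<Rightarrow> (nat \<Rightarrow> 'k) set" where
  "cycle i U = {f\<in>chain i U. case i of 0 \<Rightarrow> True | Suc p \<Rightarrow> diff p f = 0}"

definition homology_nz :: "nat \<Rightarrow> ('n \<Rightarrow> int) set \<Rightarrow> bool" where
  "homology_nz i U \<longleftrightarrow> (\<exists>z\<in>cycle i U. z \<notin> diff i ` chain (Suc i) U)"

end

definition downset :: "('n \<Rightarrow> int) set \<Rightarrow> bool" where
  "downset U \<longleftrightarrow> (\<forall>s\<in>U. \<forall>t\<le>s. t \<in> U)"

lemma downset_upset:
  fixes a :: "'n \<Rightarrow> int"
  assumes "\<And>m m'. m \<in> M \<Longrightarrow> m \<le> m' \<Longrightarrow> m' \<in> M" shows "downset {s. a - s \<in> M}"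
  unfolding downset_def
proof (intro ballI allI impI CollectI)
  fix s t assume "s \<in> {s. a - s \<in> M}" "t \<le> s"
  then show "a - t \<in> M" using assms[of "a - s" "a - t"] by (simp add: le_fun_def)
qed

lemma downset_above: "downset {s. a - s \<in> above u}"
  by (rule downset_upset) (auto simp: above_def)

lemma downset_var: "downset {s. a - s \<in> var_multiples u V}"
proof (rule downset_upset)
  fix m m' assume "m \<in> var_multiples u V" "m \<le> m'"
  then show "m' \<in> var_multiples u V"
    unfolding var_multiples_def le_fun_def mem_Collect_eq by (meson less_le_trans order_trans)
qed

text \<open>\<open>\<delta>_nz\<close> makes the chains over a downset a subcomplex.
  \<open>principal\<close> is what is kept of resolving K: S(-s) is nonzero in degree b exactly for
  \<open>s \<le> b\<close>, so \<open>{s. s \<le> b}\<close> gives the strand in degree b, whose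
  homology is that of K.\<close>

locale multigraded_complex = multigraded_data N \<sigma> \<delta>
  for N :: "nat \<Rightarrow> nat" and \<sigma> :: "nat \<Rightarrow> nat \<Rightarrow> 'n::finite \<Rightarrow> int" and \<delta> :: "nat \<Rightarrow> nat \<Rightarrow> nat \<Rightarrow> 'k::field" +
  assumes \<delta>_nz: "q < N p \<Longrightarrow> r < N (Suc p) \<Longrightarrow> \<delta> p q r \<noteq> 0 \<Longrightarrow> \<sigma> p q \<le> \<sigma> (Suc p) r"
    and diff_diff: "diff p (diff (Suc p) f) = 0"
    and principal: "homology_nz i {s. s \<le> b} \<longleftrightarrow> i = 0 \<and> b = 0"
begin

lemma diff_add: "diff p (f + g) = diff p f + diff p g"
  by (auto simp: diff_def fun_eq_iff algebra_simps sum.distrib)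

lemma diff_minus: "diff p (f - g) = diff p f - diff p g"
  by (auto simp: diff_def fun_eq_iff algebra_simps sum_subtractf)

lemma chain_add: "f \<in> chain p U \<Longrightarrow> g \<in> chain p U \<Longrightarrow> f + g \<in> chain p U"
  by (auto simp: chain_def) (metis add_0)+

lemma chain_minus: "f \<in> chain p U \<Longrightarrow> g \<in> chain p U \<Longrightarrow> f - g \<in> chain p U"
  by (auto simp: chain_def) (metis diff_0_right diff_self)+

lemma chain_mono: "f \<in> chain p U \<Longrightarrow> U \<subseteq> W \<Longrightarrow> f \<in> chain p W"
  by (auto simp: chain_def)

lemma chain_Int: "f \<in> chain p U \<Longrightarrow> f \<in> chain p W \<Longrightarrow> f \<in> chain p (U \<inter> W)"
  by (auto simp: chain_def)

lemma chain_UnE: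
  assumes "f \<in> chain p (U \<union> W)"
  obtains g h where "f = g + h" "g \<in> chain p U" "h \<in> chain p W"
proof
  show "f = (\<lambda>q. if \<sigma> p q \<in> U then f q else 0) + (\<lambda>q. if \<sigma> p q \<in> U then 0 else f q)"
    by (auto simp: fun_eq_iff)
qed (use assms in \<open>auto simp: chain_def split: if_splits\<close>)

lemma diff_chain:
  assumes "downset U" "f \<in> chain (Suc p) U" shows "diff p f \<in> chain p U"
  unfolding chain_def
proof (intro CollectI allI impI)
  fix q assume nz: "diff p f q \<noteq> 0"
  then have q: "q < N p" by (auto simp: diff_def split: if_splits)
  then have "(\<Sum>r<N (Suc p). \<delta> p q r * f r) \<noteq> 0" using nz by (simp add: diff_def)
  then obtain r where "r < N (Suc p)" "\<delta> p q r * f r \<noteq> 0"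
    by (meson lessThan_iff sum.neutral)
  then show "q < N p \<and> \<sigma> p q \<in> U" using \<delta>_nz[OF q] assms q by (auto simp: chain_def downset_def)
qed

lemma diff_cycle:
  assumes "z \<in> chain (Suc p) U" "diff p z \<in> chain p W" shows "diff p z \<in> cycle p W"
  using assms by (cases p) (simp_all add: cycle_def diff_diff)

lemma diff_chain_UnE:
  assumes "z \<in> diff p ` chain (Suc p) (U \<union> W)"
  obtains x y where "x \<in> chain (Suc p) U" "y \<in> chain (Suc p) W" "z = diff p x + diff p y"
proof -
  obtain f where f: "f \<in> chain (Suc p) (U \<union> W)" "z = diff p f" using assms by (rule imageE)
  obtain x y where "f = x + y" "x \<in> chain (Suc p) U" "y \<in> chain (Suc p) W" by (rule chain_UnE[OF f(1)])
  then show thesis using that f(2) by (simp add: diff_add)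
qed

lemma boundaryE:
  assumes "\<not> homology_nz i U" "z \<in> cycle i U"
  obtains f where "f \<in> chain (Suc i) U" "z = diff i f"
  using assms by (auto simp: homology_nz_def)

text \<open>Exactness of the Mayer-Vietoris sequence at the union; the intersection enters one index
  lower, hence the premise only for \<open>Suc p\<close>.\<close>

lemma homology_vanish_Un:
  assumes down: "downset U" "downset W"
    and U: "\<not> homology_nz i U" and W: "\<not> homology_nz i W"
    and UW: "\<And>p. i = Suc p \<Longrightarrow> \<not> homology_nz p (U \<inter> W)"
  shows "\<not> homology_nz i (U \<union> W)"
proof -
  have "z \<in> diff i ` chain (Suc i) (U \<union> W)" if z: "z \<in> cycle i (U \<union> W)" for z
  proof -
    obtain x y where xy: "z = x + y" "x \<in> cycle i U" "y \<in> cycle i W"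
    proof (cases i)
      case 0
      then have "z \<in> chain i (U \<union> W)" using z by (simp add: cycle_def)
      then show ?thesis using that 0 chain_UnE[of z i U W] by (auto simp: cycle_def)
    next
      case (Suc p)
      then have "z \<in> chain (Suc p) (U \<union> W)" and dz: "diff p z = 0" using z by (auto simp: cycle_def)
      then obtain x y where xy: "z = x + y" "x \<in> chain (Suc p) U" "y \<in> chain (Suc p) W"
        using chain_UnE by blast
      \<comment> \<open>The boundaries of x and y are opposite, so that of x is a cycle over the
        intersection and bounds some t there. Moving t from x to y makes both parts cycles.\<close>
      have "diff p x = 0 - diff p y" using dz xy(1) by (simp add: diff_add eq_neg_iff_add_eq_0)
      moreover have "0 \<in> chain p W" by (simp add: chain_def)
      ultimately have "diff p x \<in> chain p W"
        using diff_chain[OF down(2) xy(3)] chain_minus by metis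
      then have "diff p x \<in> cycle p (U \<inter> W)"
        using diff_cycle[OF xy(2)] chain_Int diff_chain[OF down(1) xy(2)] by blast
      then obtain t where t: "t \<in> chain (Suc p) (U \<inter> W)" "diff p x = diff p t"
        using boundaryE[OF UW[OF Suc]] by blast
      have "x - t \<in> cycle i U"
        using xy t chain_mono[OF t(1), of U] by (simp add: Suc cycle_def diff_minus chain_minus)
      moreover have "y + t \<in> cycle i W"
        using xy t chain_mono[OF t(1), of W] dz by (simp add: Suc cycle_def diff_add chain_add add.commute)
      moreover have "z = (x - t) + (y + t)" by (simp add: xy)
      ultimately show ?thesis using that by blast
    qed
    obtain f where "f \<in> chain (Suc i) U" "x = diff i f" using boundaryE[OF U xy(2)] .
    moreover obtain g where "g \<in> chain (Suc i) W" "y = diff i g" using boundaryE[OF W xy(3)] .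
    ultimately have "z = diff i (f + g)" "f + g \<in> chain (Suc i) (U \<union> W)"
      using xy by (auto simp: diff_add intro!: chain_add elim: chain_mono)
    then show ?thesis by blast
  qed
  then show ?thesis by (auto simp: homology_nz_def)
qed

text \<open>A class of U survives in the union: if it bounds x + y, then \<open>diff i y\<close> is
  a cycle over the intersection, hence bounds there, and y can be replaced by a chain over
  U.\<close>

lemma homology_nz_Un:
  assumes down: "downset U" "downset W"
    and U: "homology_nz i U" and UW: "\<not> homology_nz i (U \<inter> W)"
  shows "homology_nz i (U \<union> W)"
proof -
  obtain z where z: "z \<in> cycle i U" "z \<notin> diff i ` chain (Suc i) U"
    using U by (auto simp: homology_nz_def)
  have "z \<notin> diff i ` chain (Suc i) (U \<union> W)"
  proof
    assume "z \<in> diff i ` chain (Suc i) (U \<union> W)"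
    then obtain x y where xy: "x \<in> chain (Suc i) U" "y \<in> chain (Suc i) W" "z = diff i x + diff i y"
      by (rule diff_chain_UnE)
    have eq: "diff i y = z - diff i x" using xy by simp
    have "z \<in> chain i U" using z by (simp add: cycle_def)
    then have "diff i y \<in> chain i U"
      unfolding eq by (rule chain_minus) (rule diff_chain[OF down(1) xy(1)])
    then have "diff i y \<in> cycle i (U \<inter> W)"
      using diff_cycle[OF xy(2) chain_Int[OF _ diff_chain[OF down(2) xy(2)]]] by simp
    then obtain t where t: "t \<in> chain (Suc i) (U \<inter> W)" "diff i y = diff i t"
      using boundaryE[OF UW] by blast
    have "z = diff i (x + t)" using xy t by (simp add: diff_add)
    moreover have "x + t \<in> chain (Suc i) U" using xy(1) chain_mono[OF t(1)] by (auto intro: chain_add)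
    ultimately show False using z by blast
  qed
  moreover have "z \<in> cycle i (U \<union> W)" using z by (auto simp: cycle_def elim: chain_mono)
  ultimately show ?thesis by (auto simp: homology_nz_def)
qed

text \<open>A class of the intersection that bounds f over U and g over W is the image of
  \<open>f - g\<close> under the connecting map. If \<open>f - g\<close> were a boundary, f could be
  corrected to a chain over the intersection.\<close>

lemma homology_nz_Suc_Un:
  assumes down: "downset U" "downset W"
    and UW: "homology_nz i (U \<inter> W)" and U: "\<not> homology_nz i U" and W: "\<not> homology_nz i W"
  shows "homology_nz (Suc i) (U \<union> W)"
proof -
  obtain z where z: "z \<in> cycle i (U \<inter> W)" "z \<notin> diff i ` chain (Suc i) (U \<inter> W)"
    using UW by (auto simp: homology_nz_def)
  have "z \<in> cycle i U" "z \<in> cycle i W" using z by (auto simp: cycle_def elim: chain_mono)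
  then obtain f g where f: "f \<in> chain (Suc i) U" "z = diff i f" and g: "g \<in> chain (Suc i) W" "z = diff i g"
    using boundaryE[OF U] boundaryE[OF W] by metis
  have "f - g \<in> chain (Suc i) (U \<union> W)" using f g by (auto intro!: chain_minus elim: chain_mono)
  then have "f - g \<in> cycle (Suc i) (U \<union> W)" using f g by (simp add: cycle_def diff_minus)
  moreover have "f - g \<notin> diff (Suc i) ` chain (Suc (Suc i)) (U \<union> W)"
  proof
    assume "f - g \<in> diff (Suc i) ` chain (Suc (Suc i)) (U \<union> W)"
    then obtain x y where xy: "x \<in> chain (Suc (Suc i)) U" "y \<in> chain (Suc (Suc i)) W"
      "f - g = diff (Suc i) x + diff (Suc i) y"
      by (rule diff_chain_UnE)
    have eq: "f - diff (Suc i) x = g + diff (Suc i) y" using xy(3) by (simp add: algebra_simps)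
    have "f - diff (Suc i) x \<in> chain (Suc i) U"
      by (rule chain_minus[OF f(1) diff_chain[OF down(1) xy(1)]])
    moreover have "f - diff (Suc i) x \<in> chain (Suc i) W"
      unfolding eq by (rule chain_add[OF g(1) diff_chain[OF down(2) xy(2)]])
    ultimately have "f - diff (Suc i) x \<in> chain (Suc i) (U \<inter> W)" by (rule chain_Int)
    moreover have "diff i (f - diff (Suc i) x) = z" using f by (simp add: diff_minus diff_diff)
    ultimately show False using z by blast
  qed
  ultimately show ?thesis by (auto simp: homology_nz_def)
qed

definition tor_nz :: "nat \<Rightarrow> ('n \<Rightarrow> int) set \<Rightarrow> ('n \<Rightarrow> int) \<Rightarrow> bool" where
  "tor_nz i M a \<longleftrightarrow> homology_nz i {s. a - s \<in> M}"

lemma Collect_diff_Un_Int: "{s. a - s \<in> M} \<union> {s. a - s \<in> M'} = {s. a - s \<in> M \<union> M'}"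
  "{s. a - s \<in> M} \<inter> {s. a - s \<in> M'} = {s. a - s \<in> M \<inter> M'}" for a :: "'n \<Rightarrow> int"
  by auto

lemma tor_above: "tor_nz i (above u) a \<longleftrightarrow> i = 0 \<and> a = u"
proof -
  have "{s. a - s \<in> above u} = {s. s \<le> a - u}" by (auto simp: above_def le_fun_def algebra_simps)
  then show ?thesis using principal[of i "a - u"] by (simp add: tor_nz_def)
qed

lemma tor_empty: "\<not> tor_nz i {} a"
proof -
  have "z \<in> diff i ` chain (Suc i) {}" if "z \<in> chain i {}" for z
  proof -
    have "z = 0" using that by (auto simp: chain_def)
    moreover have "diff i 0 = 0" by (auto simp: diff_def fun_eq_iff)
    ultimately show ?thesis by (force simp: chain_def)
  qed
  then show ?thesis by (auto simp: tor_nz_def homology_nz_def cycle_def)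
qed

lemmas tor_Un =
  homology_vanish_Un[where U = "{s. a - s \<in> M}" and W = "{s. a - s \<in> M'}",
    unfolded Collect_diff_Un_Int, folded tor_nz_def]
  homology_nz_Un[where U = "{s. a - s \<in> M}" and W = "{s. a - s \<in> M'}",
    unfolded Collect_diff_Un_Int, folded tor_nz_def]
  homology_nz_Suc_Un[where U = "{s. a - s \<in> M}" and W = "{s. a - s \<in> M'}",
    unfolded Collect_diff_Un_Int, folded tor_nz_def] for a M M'

text \<open>Koszul homology, obtained by adjoining one variable at a time. The size is
  \<open>Suc i\<close> because this is Tor of the ideal and not of the quotient by it.\<close>

lemma tor_var_multiples:
  "tor_nz i (var_multiples u V) a \<longleftrightarrow> (\<exists>F\<subseteq>V. card F = Suc i \<and> a = u + ind F)"
proof -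
  have "finite V" by simp
  then show ?thesis
  proof (induction V arbitrary: u i rule: finite_induct)
    case empty
    show ?case using tor_empty by (auto simp: var_multiples_def)
  next
    case (insert v V)
    let ?M = "var_multiples u V" and ?M' = "above (u + ind {v})"
    note down = downset_var[of a u V] downset_above[of a "u + ind {v}"]
    note Int = var_multiples_insert(2)[OF insert.hyps(2), of u]
    have Int_iff: "tor_nz j (?M \<inter> ?M') a \<longleftrightarrow> (\<exists>F\<subseteq>V. card F = Suc j \<and> a = u + ind {v} + ind F)" for j
      unfolding Int by (rule insert.IH)
    have ins: "u + ind {v} + ind F = u + ind (insert v F)" "card (insert v F) = Suc (card F)"
      if "F \<subseteq> V" for F
    proof -
      have "v \<notin> F" using that insert.hyps(2) by blast
      then show "u + ind {v} + ind F = u + ind (insert v F)" "card (insert v F) = Suc (card F)"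
        by (simp_all add: ind_insert[of v F] add.assoc)
    qed
    show ?case
      unfolding var_multiples_insert(1)
    proof
      assume "tor_nz i (?M \<union> ?M') a"
      then consider "tor_nz i ?M a" | "tor_nz i ?M' a" | p where "i = Suc p" "tor_nz p (?M \<inter> ?M') a"
        using tor_Un(1)[OF down] by blast
      then show "\<exists>F\<subseteq>insert v V. card F = Suc i \<and> a = u + ind F"
      proof cases
        case 1
        then obtain F where "F \<subseteq> V" "card F = Suc i" "a = u + ind F"
          unfolding insert.IH by (elim exE conjE)
        then show ?thesis by (intro exI[of _ F]) (simp add: subset_insertI2)
      next
        case 2
        then have "i = 0" "a = u + ind {v}" by (simp_all add: tor_above)
        then show ?thesis by (intro exI[of _ "{v}"]) simp
      next
        case 3
        then obtain F where "F \<subseteq> V" "card F = i" "a = u + ind {v} + ind F" unfolding Int_iff by auto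
        moreover from this have "insert v F \<subseteq> insert v V" by blast
        ultimately show ?thesis using ins[of F] 3(1) by metis
      qed
    next
      assume "\<exists>F\<subseteq>insert v V. card F = Suc i \<and> a = u + ind F"
      then obtain F where F: "F \<subseteq> insert v V" "card F = Suc i" and a: "a = u + ind F" by blast
      \<comment> \<open>The total degree of a rules out cancellation: in index i the intersection
        lives one total degree higher, and in smaller indices both summands live lower.\<close>
      have deg: "sum a UNIV = sum u UNIV + 1 + int i" using F by (simp add: a)
      have notInt: "\<not> tor_nz i (?M \<inter> ?M') a"
      proof
        assume "tor_nz i (?M \<inter> ?M') a"
        then obtain G where "card G = Suc i" "a = u + ind {v} + ind G" unfolding Int_iff by auto
        then show False using deg by simp
      qed
      show "tor_nz i (?M \<union> ?M') a"
      proof (cases "v \<in> F")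
        case False
        then have "F \<subseteq> V" using F by blast
        then have "tor_nz i ?M a" unfolding insert.IH using F a by (intro exI[of _ F]) simp
        then show ?thesis using tor_Un(2)[OF down] notInt by blast
      next
        case True
        define G where "G = F - {v}"
        have G: "G \<subseteq> V" "v \<notin> G" "F = insert v G" "card G = i"
          using F True by (auto simp: G_def)
        show ?thesis
        proof (cases i)
          case 0
          then have "tor_nz i ?M' a" using G finite[of G] by (simp add: tor_above a)
          then show ?thesis using tor_Un(2)[OF down(2,1)] notInt by (simp add: Un_commute Int_commute)
        next
          case (Suc p)
          have "tor_nz p (?M \<inter> ?M') a"
            unfolding Int_iff using G Suc ins[OF G(1)] a by auto
          moreover have "\<not> tor_nz p ?M a"
          proof
            assume "tor_nz p ?M a"
            then obtain H where "card H = Suc p" "a = u + ind H" unfolding insert.IH by (elim exE conjE)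
            then show False using deg Suc by simp
          qed
          moreover have "\<not> tor_nz p ?M' a"
          proof
            assume "tor_nz p ?M' a"
            then have "a = u + ind {v}" by (simp add: tor_above)
            then show False using deg Suc by simp
          qed
          ultimately show ?thesis unfolding Suc using tor_Un(3)[OF down] by blast
        qed
      qed
    qed
  qed
qed

end

section \<open>Tor along initial segments of the lexicographic order\<close>

locale m_convex_complex = m_convex B d + multigraded_complex N \<sigma> \<delta>
  for B :: "('n::finite \<Rightarrow> int) set" and d :: int and N :: "nat \<Rightarrow> nat"
    and \<sigma> :: "nat \<Rightarrow> nat \<Rightarrow> 'n \<Rightarrow> int" and \<delta> :: "nat \<Rightarrow> nat \<Rightarrow> nat \<Rightarrow> 'k::field"
begin

text \<open>\<open>lead\<close> refers to all of B, which is why L has to contain every element of B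
  preceding one of its own: the swaps behind \<open>lead e u\<close> then lie in L. If u is last in
  L, the ideal of the others meets \<open>above u\<close> in u times the variables of
  \<open>lead e u\<close>.\<close>

lemma tor_initial_segment:
  assumes "inj e" "L \<subseteq> B" "\<And>w x. w \<in> L \<Longrightarrow> x \<in> B \<Longrightarrow> before e x w \<Longrightarrow> x \<in> L"
  shows "tor_nz i (\<Union>w\<in>L. above w) a \<longleftrightarrow> (\<exists>u\<in>L. \<exists>F\<subseteq>lead e u. card F = i \<and> a = u + ind F)"
  using assms(2,3)
proof (induction "card L" arbitrary: L i)
  case 0
  then have "L = {}" using finite_subset[OF _ fin] card_0_eq by metis
  then show ?case using tor_empty by simp
next
  case (Suc n)
  have finL: "finite L" using Suc.prems fin finite_subset by blast
  obtain u where u: "u \<in> L" "\<And>w. w \<in> L \<Longrightarrow> w \<noteq> u \<Longrightarrow> before e w u \<and> \<not> before e u w"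
    using last_exists[OF assms(1) finL] Suc.hyps(2) by (metis card.empty nat.distinct(1))
  define K where "K = L - {u}"
  have L: "L = insert u K" "u \<notin> K" using u by (auto simp: K_def)
  have uB: "u \<in> B" "K \<subseteq> B" using Suc.prems(1) L by auto
  let ?M = "\<Union>w\<in>K. above w"
  have IH: "tor_nz j ?M a \<longleftrightarrow> (\<exists>u\<in>K. \<exists>F\<subseteq>lead e u. card F = j \<and> a = u + ind F)" for j
  proof (rule Suc.hyps(1))
    show "n = card K" using Suc.hyps(2) finL u by (simp add: K_def)
    show "K \<subseteq> B" by (rule uB)
    fix w x assume wx: "w \<in> K" "x \<in> B" "before e x w"
    then have "x \<in> L" using Suc.prems(2) L by blast
    moreover have "x \<noteq> u" using u wx L by blast
    ultimately show "x \<in> K" by (simp add: L)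
  qed
  \<comment> \<open>Again total degrees separate the terms: index j means d + j for the shorter
    segment and d + 1 + j for the intersection.\<close>
  have deg_IH: "sum a UNIV = d + int j" if "tor_nz j ?M a" for j
    using that degree uB unfolding IH by auto
  have Int: "?M \<inter> above u = var_multiples u (lead e u)"
  proof
    show "?M \<inter> above u \<subseteq> var_multiples u (lead e u)"
    proof
      fix m assume "m \<in> ?M \<inter> above u"
      then obtain w where w: "w \<in> K" "w \<le> m" "u \<le> m" by (auto simp: above_def)
      then have "before e w u" using u L by auto
      then obtain v where "v \<in> lead e u" "u v < w v"
        using before_imp_lead[OF assms(1)] w uB by blast
      moreover have "w v \<le> m v" using w by (simp add: le_fun_def)
      ultimately show "m \<in> var_multiples u (lead e u)" using w by (force simp: var_multiples_def)
    qed
    show "var_multiples u (lead e u) \<subseteq> ?M \<inter> above u"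
    proof
      fix m assume "m \<in> var_multiples u (lead e u)"
      then obtain v l where m: "u \<le> m" "u v < m v" "e l < e v" "swap l v u \<in> B"
        by (auto simp: var_multiples_def lead_def)
      have bef: "before e (swap l v u) u" by (rule before_swap) (rule m)
      then have "swap l v u \<in> L" using Suc.prems(2)[OF u(1) m(4)] by simp
      moreover have "swap l v u \<noteq> u" using bef before_irrefl by metis
      ultimately have "swap l v u \<in> K" by (simp add: L)
      moreover have "swap l v u \<le> m"
      proof (rule le_funI)
        fix x
        have "u x \<le> m x" using m(1) by (simp add: le_fun_def)
        then show "swap l v u x \<le> m x" using m(2) by (auto simp: swap_def of_bool_def)
      qed
      ultimately show "m \<in> ?M \<inter> above u" using m(1) unfolding above_def by blast
    qed
  qed
  have Int_iff: "tor_nz j (?M \<inter> above u) a \<longleftrightarrow> (\<exists>F\<subseteq>lead e u. card F = Suc j \<and> a = u + ind F)" for j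
    unfolding Int by (rule tor_var_multiples)
  have deg_Int: "sum a UNIV = d + 1 + int j" if "tor_nz j (?M \<inter> above u) a" for j
    using that degree[OF uB(1)] unfolding Int_iff by auto
  have "downset {s. a - s \<in> ?M}"
    by (rule downset_upset, unfold above_def, blast intro: order_trans)
  note down = this downset_above[of a u]
  have Un: "(\<Union>w\<in>L. above w) = ?M \<union> above u" by (auto simp: L)
  show ?case
    unfolding Un
  proof
    assume "tor_nz i (?M \<union> above u) a"
    then consider "tor_nz i ?M a" | "tor_nz i (above u) a" | p where "i = Suc p" "tor_nz p (?M \<inter> above u) a"
      using tor_Un(1)[OF down] by blast
    then show "\<exists>u\<in>L. \<exists>F\<subseteq>lead e u. card F = i \<and> a = u + ind F"
    proof cases
      case 1
      then show ?thesis unfolding IH using L(1) by blast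
    next
      case 2
      then have "i = 0" "a = u" by (simp_all add: tor_above)
      then show ?thesis using u(1) by (intro bexI[of _ u] exI[of _ "{}"]) simp_all
    next
      case 3
      then obtain F where "F \<subseteq> lead e u" "card F = i" "a = u + ind F"
        unfolding Int_iff by (elim exE conjE) simp
      then show ?thesis using u(1) by blast
    qed
  next
    assume "\<exists>u\<in>L. \<exists>F\<subseteq>lead e u. card F = i \<and> a = u + ind F"
    then obtain w F where F: "w \<in> L" "F \<subseteq> lead e w" "card F = i" "a = w + ind F" by blast
    have deg: "sum a UNIV = d + int i" using F degree Suc.prems(1) by auto
    have notInt: "\<not> tor_nz i (?M \<inter> above u) a" using deg deg_Int[of i] by linarith
    show "tor_nz i (?M \<union> above u) a"
    proof (cases "w = u")
      case False
      then have "w \<in> K" using F(1) L by blast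
      then have "tor_nz i ?M a" unfolding IH using F by blast
      then show ?thesis using tor_Un(2)[OF down] notInt by blast
    next
      case True
      show ?thesis
      proof (cases i)
        case 0
        then have "F = {}" using F finite[of F] by simp
        then have "tor_nz i (above u) a" using 0 F(4) True by (simp add: tor_above)
        then show ?thesis using tor_Un(2)[OF down(2,1)] notInt by (simp add: Un_commute Int_commute)
      next
        case (Suc p)
        have "tor_nz p (?M \<inter> above u) a" unfolding Int_iff using F True Suc by (intro exI[of _ F]) simp
        moreover have "\<not> tor_nz p ?M a" using deg deg_IH[of p] Suc by linarith
        moreover have "\<not> tor_nz p (above u) a" using deg degree[OF uB(1)] Suc by (auto simp: tor_above)
        ultimately show ?thesis unfolding Suc using tor_Un(3)[OF down] by blast
      qed
    qed
  qed
qed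

theorem tor_iff_hs_set: "tor_nz i (\<Union>b\<in>B. above b) a \<longleftrightarrow> a \<in> hs_set i B"
proof -
  obtain e :: "'n \<Rightarrow> nat" where e: "inj e"
    using finite_imp_inj_to_nat_seg[of "UNIV :: 'n set"] by auto
  show ?thesis
    using tor_initial_segment[OF e, of B i a] hs_set_iff_lead[OF e, of a i] by blast
qed

end

section \<open>Monomial ideals\<close>

text \<open>Integer values keep differences such as \<open>a - s\<close> and the vectors
  \<open>swap v j b\<close> meaningful, where subtraction on \<open>nat\<close> would
  truncate.\<close>

definition expo :: "('n \<Rightarrow>\<^sub>0 nat) \<Rightarrow> 'n \<Rightarrow> int" where
  "expo k = (\<lambda>v. int (Poly_Mapping.lookup k v))"

definition upset :: "('n \<Rightarrow> int) set \<Rightarrow> ('n \<Rightarrow> int) set" where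
  "upset A = (\<Union>a\<in>A. above a)"

definition mon_ideal :: "('n \<Rightarrow> int) set \<Rightarrow> ('n, 'k::comm_ring_1) mpoly set" where
  "mon_ideal M = {f. \<forall>k\<in>Poly_Mapping.keys f. expo k \<in> M}"

lemma expo_add: "expo (a + b) = expo a + expo b"
  by (auto simp: expo_def lookup_add)

lemma expo_zero [simp]: "expo 0 = 0"
  by (auto simp: expo_def)

lemma expo_single: "expo (Poly_Mapping.single v 1) = ind {v}"
  by (auto simp: expo_def ind_def lookup_single when_def)

lemma expo_inj [simp]: "expo a = expo b \<longleftrightarrow> a = b"
  by (auto simp: expo_def fun_eq_iff intro: poly_mapping_eqI)

lemma expo_nonneg: "0 \<le> expo k"
  by (simp add: expo_def le_fun_def)

lemma expo_surj:
  fixes m :: "'n::finite \<Rightarrow> int"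
  assumes "0 \<le> m" obtains k where "expo k = m"
proof
  show "expo (Abs_poly_mapping (\<lambda>v. nat (m v))) = m"
    using assms by (auto simp: expo_def le_fun_def)
qed

lemma expo_le_iff: "expo a \<le> expo b \<longleftrightarrow> (\<exists>c. b = a + c)"
proof
  assume "expo a \<le> expo b"
  then have "b = a + (b - a)"
    by (intro poly_mapping_eqI) (simp add: expo_def le_fun_def lookup_add lookup_minus)
  then show "\<exists>c. b = a + c" ..
qed (auto simp: le_fun_def expo_def lookup_add)

lemma upset_up: "m \<in> upset A \<Longrightarrow> m \<le> m' \<Longrightarrow> m' \<in> upset A"
  unfolding upset_def above_def by (blast intro: order_trans)

lemma mon_ideal_subspace:
  assumes "\<And>m m'. m \<in> M \<Longrightarrow> m \<le> m' \<Longrightarrow> m' \<in> M"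
  shows "Modules.module.subspace (*) (mon_ideal M :: ('n, 'k::comm_ring_1) mpoly set)"
proof -
  interpret Modules.module "(*) :: ('n, 'k) mpoly \<Rightarrow> _" by (rule module_times)
  show ?thesis
    unfolding subspace_def
  proof (intro conjI ballI allI)
    show "(0 :: ('n, 'k) mpoly) \<in> mon_ideal M" by (simp add: mon_ideal_def)
    fix x y :: "('n, 'k) mpoly" assume x: "x \<in> mon_ideal M"
    show "x + y \<in> mon_ideal M" if "y \<in> mon_ideal M"
      using x that keys_add[of x y] unfolding mon_ideal_def by blast
    fix c :: "('n, 'k) mpoly"
    show "c * x \<in> mon_ideal M"
      unfolding mon_ideal_def
    proof (intro CollectI ballI)
      fix k assume "k \<in> Poly_Mapping.keys (c * x)"
      then obtain a b where "k = a + b" "b \<in> Poly_Mapping.keys x" using keys_mult[of c x] by blast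
      moreover have "expo b \<le> expo (a + b)" unfolding expo_le_iff by (metis add.commute)
      ultimately show "expo k \<in> M" using x assms unfolding mon_ideal_def by blast
    qed
  qed
qed

lemma sum_monomials: "f = (\<Sum>k\<in>Poly_Mapping.keys f. Poly_Mapping.single k (Poly_Mapping.lookup f k))"
  by (rule poly_mapping_eqI) (auto simp: lookup_sum lookup_single when_def in_keys_iff sum.delta)

lemma ideal_gen_monomials:
  "(ideal_gen (monomial ` A) :: ('n, 'k::comm_ring_1) mpoly set) = mon_ideal (upset (expo ` A))"
  (is "_ = ?I")
proof -
  interpret Modules.module "(*) :: ('n, 'k) mpoly \<Rightarrow> _" by (rule module_times)
  show ?thesis
  proof
    have "monomial ` A \<subseteq> ?I"
      by (auto simp: monomial_def mon_ideal_def upset_def above_def)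
    then show "ideal_gen (monomial ` A) \<subseteq> ?I"
      unfolding ideal_gen_def by (rule span_minimal) (rule mon_ideal_subspace[OF upset_up])
    show "?I \<subseteq> ideal_gen (monomial ` A)"
    proof
      fix f assume f: "f \<in> ?I"
      have "Poly_Mapping.single k c \<in> ideal_gen (monomial ` A)" if k: "k \<in> Poly_Mapping.keys f" for k and c :: 'k
      proof -
        obtain a where "a \<in> A" "expo a \<le> expo k"
          using f k by (auto simp: mon_ideal_def upset_def above_def)
        then obtain b where "k = b + a" unfolding expo_le_iff by (metis add.commute)
        then have "Poly_Mapping.single k c = Poly_Mapping.single b c * monomial a"
          by (simp add: monomial_def mult_single)
        also have "\<dots> \<in> span (monomial ` A)" using \<open>a \<in> A\<close> by (intro span_scale span_base) simp
        finally show ?thesis by (simp add: ideal_gen_def)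
      qed
      then have "(\<Sum>k\<in>Poly_Mapping.keys f. Poly_Mapping.single k (Poly_Mapping.lookup f k))
          \<in> ideal_gen (monomial ` A)"
        unfolding ideal_gen_def by (intro span_sum)
      then show "f \<in> ideal_gen (monomial ` A)" by (simp flip: sum_monomials)
    qed
  qed
qed

lemma ideal_mult_monomials:
  "ideal_mult (ideal_gen (monomial ` A)) (ideal_gen (monomial ` C))
    = (ideal_gen (monomial ` {a + c | a c. a \<in> A \<and> c \<in> C}) :: ('n, 'k::comm_ring_1) mpoly set)"
  (is "?L = ?R")
proof -
  interpret Modules.module "(*) :: ('n, 'k) mpoly \<Rightarrow> _" by (rule module_times)
  show ?thesis
  proof
    have "f * g \<in> ?R" if f: "f \<in> ideal_gen (monomial ` A)" and g: "g \<in> ideal_gen (monomial ` C)"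
      for f g :: "('n, 'k) mpoly"
      unfolding ideal_gen_monomials mon_ideal_def
    proof (intro CollectI ballI)
      fix k assume "k \<in> Poly_Mapping.keys (f * g)"
      then obtain x y where k: "k = x + y" "x \<in> Poly_Mapping.keys f" "y \<in> Poly_Mapping.keys g"
        using keys_mult[of f g] by blast
      obtain a where a: "a \<in> A" "expo a \<le> expo x"
        using f k(2) unfolding ideal_gen_monomials mon_ideal_def upset_def above_def by blast
      obtain c where c: "c \<in> C" "expo c \<le> expo y"
        using g k(3) unfolding ideal_gen_monomials mon_ideal_def upset_def above_def by blast
      have "expo (a + c) \<le> expo k"
        using a(2) c(2) unfolding k(1) expo_add by (auto simp: le_fun_def intro: add_mono)
      then show "expo k \<in> upset (expo ` {a + c | a c. a \<in> A \<and> c \<in> C})"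
        unfolding upset_def above_def using a(1) c(1) by blast
    qed
    then show "?L \<subseteq> ?R"
      unfolding ideal_mult_def
      by (subst ideal_gen_def) (intro span_minimal; auto simp: ideal_gen_def)
    have "(monomial (a + c) :: ('n, 'k) mpoly)
        \<in> {f * g | f g. f \<in> ideal_gen (monomial ` A) \<and> g \<in> ideal_gen (monomial ` C)}"
      if "a \<in> A" "c \<in> C" for a c
    proof -
      have "monomial (a + c) = monomial a * (monomial c :: ('n, 'k) mpoly)"
        by (simp add: monomial_def mult_single)
      moreover have "(monomial a :: ('n, 'k) mpoly) \<in> ideal_gen (monomial ` A)"
        "(monomial c :: ('n, 'k) mpoly) \<in> ideal_gen (monomial ` C)"
        using that unfolding ideal_gen_def by (auto intro: span_base)
      ultimately show ?thesis by blast
    qed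
    then show "?R \<subseteq> ?L"
      unfolding ideal_mult_def
      by (subst ideal_gen_def) (intro span_minimal; auto simp: ideal_gen_def intro: span_base)
  qed
qed

section \<open>Powers of monomial ideals\<close>

primrec sumpow :: "nat \<Rightarrow> 'a::comm_monoid_add set \<Rightarrow> 'a set" where
  "sumpow 0 A = {0}"
| "sumpow (Suc k) A = {a + c | a c. a \<in> A \<and> c \<in> sumpow k A}"

lemma ideal_power_monomials: "ideal_power (ideal_gen (monomial ` A)) k = ideal_gen (monomial ` sumpow k A)"
proof (induction k)
  case 0
  show ?case
    unfolding sumpow.simps ideal_power.simps ideal_gen_monomials
    by (auto simp: mon_ideal_def upset_def above_def expo_nonneg)
next
  case (Suc k)
  then show ?case by (simp add: ideal_mult_monomials)
qed

lemma expo_sumpow: "expo ` sumpow k A = sumpow k (expo ` A)"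
proof (induction k)
  case (Suc k)
  have "expo ` sumpow (Suc k) A = {expo a + expo c | a c. a \<in> A \<and> c \<in> sumpow k A}"
    unfolding sumpow.simps expo_add[symmetric] by blast
  also have "\<dots> = sumpow (Suc k) (expo ` A)" unfolding sumpow.simps Suc[symmetric] by blast
  finally show ?case .
qed (simp add: zero_fun_def)

lemma m_convex_sumpow:
  assumes "m_convex B d" shows "m_convex (sumpow k B) (int k * d)"
proof (induction k)
  case 0
  show ?case by unfold_locales (auto simp: exchange_def)
next
  case (Suc k)
  interpret b: m_convex B d by (rule assms)
  interpret c: m_convex "sumpow k B" "int k * d" by (rule Suc)
  have eq: "sumpow (Suc k) B = {\<lambda>x. b x + c x | b c. b \<in> B \<and> c \<in> sumpow k B}"
    by (auto simp: plus_fun_def)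
  show ?case
  proof
    have "sumpow (Suc k) B = (\<lambda>(b, c). b + c) ` (B \<times> sumpow k B)" by auto
    then show "finite (sumpow (Suc k) B)" using b.fin c.fin by simp
    show "sumpow (Suc k) B \<noteq> {}" using b.nonempty c.nonempty by auto
    show "sum b UNIV = int (Suc k) * d" if "b \<in> sumpow (Suc k) B" for b
      using that b.degree c.degree by (auto simp: sum.distrib algebra_simps)
    show "exchange (sumpow (Suc k) B)" unfolding eq by (rule exchange_sumset[OF b.exch c.exch])
  qed
qed

section \<open>The graded maximal ideal as an associated prime\<close>

lemma graded_max_ideal_eq:
  "(graded_max_ideal :: ('n, 'k::comm_ring_1) mpoly set) = {g. Poly_Mapping.lookup g 0 = 0}"
proof -
  have "range (\<lambda>v. monomial (Poly_Mapping.single v 1) :: ('n, 'k) mpoly)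
      = monomial ` range (\<lambda>v. Poly_Mapping.single v 1)" by auto
  then have "graded_max_ideal = (mon_ideal (upset (expo ` range (\<lambda>v. Poly_Mapping.single v 1))) :: ('n, 'k) mpoly set)"
    by (simp add: graded_max_ideal_def ideal_gen_monomials)
  moreover have "expo k \<in> upset (expo ` range (\<lambda>v. Poly_Mapping.single v 1)) \<longleftrightarrow> k \<noteq> 0" for k :: "'n \<Rightarrow>\<^sub>0 nat"
  proof
    assume "expo k \<in> upset (expo ` range (\<lambda>v. Poly_Mapping.single v 1))"
    then obtain v where "expo (Poly_Mapping.single v 1) \<le> expo k" by (auto simp: upset_def above_def)
    from le_funD[OF this, of v] show "k \<noteq> 0" by (auto simp: expo_def)
  next
    assume "k \<noteq> 0"
    then obtain v where "Poly_Mapping.lookup k v \<noteq> 0" by (metis lookup_zero poly_mapping_eqI)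
    then have "expo (Poly_Mapping.single v 1) \<le> expo k"
      by (auto simp: expo_def le_fun_def lookup_single when_def)
    then show "expo k \<in> upset (expo ` range (\<lambda>v. Poly_Mapping.single v 1))"
      by (auto simp: upset_def above_def)
  qed
  ultimately have "graded_max_ideal = {f :: ('n, 'k) mpoly. \<forall>k\<in>Poly_Mapping.keys f. k \<noteq> 0}"
    by (simp add: mon_ideal_def)
  also have "\<dots> = {g. Poly_Mapping.lookup g 0 = 0}" by (metis in_keys_iff)
  finally show ?thesis .
qed

lemma lookup_monomial_mult:
  "Poly_Mapping.lookup (Poly_Mapping.single t c * f) (t + k) = c * Poly_Mapping.lookup f k"
  for f :: "('n, 'k::comm_ring_1) mpoly"
proof -
  have "Poly_Mapping.single t c * f
      = (\<Sum>l\<in>Poly_Mapping.keys f. Poly_Mapping.single (t + l) (c * Poly_Mapping.lookup f l))"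
    by (subst (1) sum_monomials[of f]) (simp add: sum_distrib_left mult_single)
  then show ?thesis
    by (auto simp: lookup_sum lookup_single when_def in_keys_iff sum.delta)
qed

lemma keys_monomial_mult:
  assumes "m \<in> Poly_Mapping.keys (Poly_Mapping.single t c * f)"
  obtains k where "m = t + k" "k \<in> Poly_Mapping.keys f"
proof -
  have "Poly_Mapping.keys (Poly_Mapping.single t c) \<subseteq> {t}" by simp
  then show thesis using that assms keys_mult[of "Poly_Mapping.single t c" f] by fastforce
qed

text \<open>Both sides express that the quotient has a nonzero socle. Membership in a monomial ideal
  is decided term by term, so any term of f outside the ideal is a socle monomial; conversely, the
  annihilator of such a monomial is the graded maximal ideal.\<close>

lemma Ass_mon_ideal_iff:
  "graded_max_ideal \<in> Ass (mon_ideal (upset A) :: ('n::finite, 'k::field) mpoly set)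
    \<longleftrightarrow> (\<exists>u. 0 \<le> u \<and> u \<notin> upset A \<and> (\<forall>v. u + ind {v} \<in> upset A))"
proof
  assume "graded_max_ideal \<in> Ass (mon_ideal (upset A) :: ('n::finite, 'k::field) mpoly set)"
  then obtain f :: "('n, 'k) mpoly" where f: "{g. Poly_Mapping.lookup g 0 = 0} = {g. g * f \<in> mon_ideal (upset A)}"
    unfolding Ass_def graded_max_ideal_eq by blast
  have "1 \<notin> {g. g * f \<in> mon_ideal (upset A)}" unfolding f[symmetric] by (simp add: lookup_one)
  then obtain k where k: "k \<in> Poly_Mapping.keys f" "expo k \<notin> upset A" by (auto simp: mon_ideal_def)
  have "expo k + ind {v} \<in> upset A" for v
  proof -
    let ?x = "Poly_Mapping.single (Poly_Mapping.single v 1) 1 :: ('n, 'k) mpoly"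
    have "Poly_Mapping.single v (1::nat) \<noteq> 0" by (metis lookup_single_eq lookup_zero one_neq_zero)
    then have "?x \<in> {g. Poly_Mapping.lookup g 0 = 0}" by (simp add: lookup_single when_def)
    then have "?x * f \<in> mon_ideal (upset A)" unfolding f by simp
    moreover have "Poly_Mapping.single v 1 + k \<in> Poly_Mapping.keys (?x * f)"
      using k(1) by (simp add: in_keys_iff lookup_monomial_mult)
    ultimately have "expo (Poly_Mapping.single v 1 + k) \<in> upset A" by (auto simp: mon_ideal_def)
    then show ?thesis unfolding expo_add expo_single by (simp add: add.commute)
  qed
  then show "\<exists>u. 0 \<le> u \<and> u \<notin> upset A \<and> (\<forall>v. u + ind {v} \<in> upset A)" using k(2) expo_nonneg[of k] by blast
next
  assume "\<exists>u. 0 \<le> u \<and> u \<notin> upset A \<and> (\<forall>v. u + ind {v} \<in> upset A)"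
  then obtain k where k: "expo k \<notin> upset A" "\<And>v. expo k + ind {v} \<in> upset A" using expo_surj by metis
  have "Poly_Mapping.lookup g 0 = 0 \<longleftrightarrow> g * Poly_Mapping.single k 1 \<in> mon_ideal (upset A)" for g :: "('n, 'k) mpoly"
  proof
    assume g: "Poly_Mapping.lookup g 0 = 0"
    show "g * Poly_Mapping.single k 1 \<in> mon_ideal (upset A)"
      unfolding mon_ideal_def mult.commute[of g]
    proof (intro CollectI ballI)
      fix m assume "m \<in> Poly_Mapping.keys (Poly_Mapping.single k 1 * g)"
      then obtain l where l: "m = k + l" "l \<in> Poly_Mapping.keys g" by (rule keys_monomial_mult)
      then have "l \<noteq> 0" using g by (auto simp: in_keys_iff)
      then obtain v where "Poly_Mapping.lookup l v \<noteq> 0" by (metis lookup_zero poly_mapping_eqI)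
      then have "expo k + ind {v} \<le> expo m"
        by (auto simp: l(1) lookup_add ind_def le_fun_def expo_def)
      then show "expo m \<in> upset A" using upset_up k(2) by blast
    qed
  next
    assume "g * Poly_Mapping.single k 1 \<in> mon_ideal (upset A)"
    then have "k \<notin> Poly_Mapping.keys (Poly_Mapping.single k 1 * g)"
      using k(1) by (auto simp: mon_ideal_def mult.commute)
    then show "Poly_Mapping.lookup g 0 = 0"
      using lookup_monomial_mult[of k 1 g 0] by (simp add: in_keys_iff)
  qed
  then have eq: "graded_max_ideal = {g :: ('n, 'k) mpoly. g * Poly_Mapping.single k 1 \<in> mon_ideal (upset A)}"
    by (simp add: graded_max_ideal_eq)
  \<comment> \<open>Constant terms multiply, which gives primality. Once the constant of f is split
    off, no product of terms is constant, since exponents cannot cancel.\<close>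
  have lookup0: "Poly_Mapping.lookup (f * g) 0 = Poly_Mapping.lookup f 0 * Poly_Mapping.lookup g 0"
    for f g :: "('n, 'k) mpoly"
  proof -
    define h where "h = f - Poly_Mapping.single 0 (Poly_Mapping.lookup f 0)"
    have "Poly_Mapping.lookup (h * g) 0 = 0"
    proof (rule ccontr)
      assume "Poly_Mapping.lookup (h * g) 0 \<noteq> 0"
      then obtain a b where ab: "0 = a + b" "a \<in> Poly_Mapping.keys h"
        using keys_mult[of h g] by (force simp: in_keys_iff)
      then have "a = 0"
        by (intro poly_mapping_eqI) (metis add_is_0 lookup_add lookup_zero)
      then show False using ab(2) by (simp add: h_def in_keys_iff lookup_minus)
    qed
    moreover have "f * g = h * g + Poly_Mapping.single 0 (Poly_Mapping.lookup f 0) * g"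
      by (simp add: h_def algebra_simps)
    ultimately show ?thesis
      using lookup_monomial_mult[of 0 "Poly_Mapping.lookup f 0" g 0] by (simp add: lookup_add)
  qed
  have "prime_ideal (graded_max_ideal :: ('n, 'k) mpoly set)"
    unfolding prime_ideal_def
  proof (intro conjI allI impI)
    interpret Modules.module "(*) :: ('n, 'k) mpoly \<Rightarrow> _" by (rule module_times)
    show "is_ideal (graded_max_ideal :: ('n, 'k) mpoly set)"
      unfolding is_ideal_def graded_max_ideal_def ideal_gen_def by (rule subspace_span)
    have "(1 :: ('n, 'k) mpoly) \<notin> graded_max_ideal" by (simp add: graded_max_ideal_eq lookup_one)
    then show "(graded_max_ideal :: ('n, 'k) mpoly set) \<noteq> UNIV" by blast
    fix f g :: "('n, 'k) mpoly" assume "f * g \<in> graded_max_ideal"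
    then show "f \<in> graded_max_ideal \<or> g \<in> graded_max_ideal" by (simp add: graded_max_ideal_eq lookup0)
  qed
  then show "graded_max_ideal \<in> Ass (mon_ideal (upset A) :: ('n, 'k) mpoly set)"
    unfolding Ass_def using eq by blast
qed

section \<open>Tor from an arbitrary resolution\<close>

definition nonneg :: "('n \<Rightarrow>\<^sub>0 int) \<Rightarrow> bool" where
  "nonneg z \<longleftrightarrow> (\<forall>v. 0 \<le> Poly_Mapping.lookup z v)"

definition nat_part :: "('n \<Rightarrow>\<^sub>0 int) \<Rightarrow> 'n \<Rightarrow>\<^sub>0 nat" where
  "nat_part z = Poly_Mapping.map nat z"

text \<open>Graded pieces of S have dimension at most 1. Together with
  \<open>coeff_of_degree\<close> this identifies the piece of degree z with K; if z has a negative
  entry the piece is zero and both maps return 0.\<close>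

definition term_of_degree :: "('n \<Rightarrow>\<^sub>0 int) \<Rightarrow> 'k \<Rightarrow> ('n, 'k::comm_ring_1) mpoly" where
  "term_of_degree z k = (if nonneg z then Poly_Mapping.single (nat_part z) k else 0)"

definition coeff_of_degree :: "('n \<Rightarrow>\<^sub>0 int) \<Rightarrow> ('n, 'k::comm_ring_1) mpoly \<Rightarrow> 'k" where
  "coeff_of_degree z f = (if nonneg z then Poly_Mapping.lookup f (nat_part z) else 0)"

lemma nonneg_iff: "nonneg z \<longleftrightarrow> 0 \<le> Poly_Mapping.lookup z"
  by (simp add: nonneg_def le_fun_def)

lemma nonneg_diff_iff: "nonneg (x - y) \<longleftrightarrow> Poly_Mapping.lookup y \<le> Poly_Mapping.lookup x"
  by (simp add: nonneg_def le_fun_def lookup_minus)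

lemma nonneg_zero [simp]: "nonneg 0"
  by (simp add: nonneg_def)

lemma nonneg_add: "nonneg x \<Longrightarrow> nonneg y \<Longrightarrow> nonneg (x + y)"
  by (simp add: nonneg_def lookup_add)

lemma lookup_nat_part: "Poly_Mapping.lookup (nat_part z) v = nat (Poly_Mapping.lookup z v)"
  by (simp add: nat_part_def map.rep_eq when_def)

lemma nat_part_zero [simp]: "nat_part 0 = 0"
  by (intro poly_mapping_eqI) (simp add: lookup_nat_part)

lemma expo_nat_part: "nonneg z \<Longrightarrow> expo (nat_part z) = Poly_Mapping.lookup z"
  by (auto simp: expo_def lookup_nat_part nonneg_def)

lemma nat_part_add: "nonneg x \<Longrightarrow> nonneg y \<Longrightarrow> nat_part (x + y) = nat_part x + nat_part y"
  by (intro poly_mapping_eqI) (simp add: lookup_nat_part lookup_add nat_add_distrib nonneg_def)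

lemma lookup_multideg: "Poly_Mapping.lookup (multideg a) = expo a"
  by (auto simp: multideg_def expo_def map.rep_eq when_def)

lemma multideg_eq_iff: "multideg m = z \<longleftrightarrow> nonneg z \<and> m = nat_part z"
proof
  assume "multideg m = z"
  then have z: "Poly_Mapping.lookup z = expo m" using lookup_multideg by blast
  then have "nonneg z" by (simp add: nonneg_iff expo_nonneg)
  then show "nonneg z \<and> m = nat_part z" using expo_nat_part[of z] z by simp
next
  assume "nonneg z \<and> m = nat_part z"
  then show "multideg m = z" by (intro poly_mapping_eqI) (simp add: lookup_multideg expo_nat_part)
qed

lemma homogeneous_term: "homogeneous z (term_of_degree z k)"
  by (auto simp: homogeneous_def term_of_degree_def multideg_eq_iff)

lemma homogeneousD:
  assumes "homogeneous z f" shows "f = term_of_degree z (coeff_of_degree z f)"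
proof (rule poly_mapping_eqI)
  fix m
  have "Poly_Mapping.lookup f m \<noteq> 0 \<longrightarrow> nonneg z \<and> m = nat_part z"
    using assms by (auto simp: homogeneous_def multideg_eq_iff in_keys_iff)
  then show "Poly_Mapping.lookup f m = Poly_Mapping.lookup (term_of_degree z (coeff_of_degree z f)) m"
    by (auto simp: term_of_degree_def coeff_of_degree_def lookup_single when_def)
qed

lemma coeff_term: "coeff_of_degree z (term_of_degree z k) = (if nonneg z then k else 0)"
  by (simp add: coeff_of_degree_def term_of_degree_def)

lemma coeff_sum: "coeff_of_degree z (sum f A) = (\<Sum>x\<in>A. coeff_of_degree z (f x))"
  by (simp add: coeff_of_degree_def lookup_sum)

lemma term_sum: "term_of_degree z (sum f A) = (\<Sum>x\<in>A. term_of_degree z (f x))"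
proof (cases "nonneg z")
  case True
  show ?thesis
    by (rule poly_mapping_eqI)
      (simp add: term_of_degree_def True lookup_sum lookup_single when_def sum.If_cases)
qed (simp add: term_of_degree_def)

lemma term_zero [simp]: "term_of_degree z 0 = 0"
  by (simp add: term_of_degree_def)

lemma coeff_zero [simp]: "coeff_of_degree z 0 = 0"
  by (simp add: coeff_of_degree_def)

lemma term_mult_term:
  "nonneg x \<Longrightarrow> nonneg y \<Longrightarrow> term_of_degree x k * term_of_degree y l = term_of_degree (x + y) (k * l)"
  by (simp add: term_of_degree_def nonneg_add nat_part_add mult_single)

lemma coeff_term_mult:
  assumes x: "nonneg x"
  shows "coeff_of_degree (x + y) (term_of_degree x k * f) = k * coeff_of_degree y f"
proof (cases "nonneg y")
  case True
  then show ?thesis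
    using x by (simp add: coeff_of_degree_def term_of_degree_def nonneg_add nat_part_add lookup_monomial_mult)
next
  case False
  \<comment> \<open>Here y has a negative entry although x + y may have none. The monomials of the
    product are multiples of the first factor, so one of degree x + y would make y
    nonnegative.\<close>
  have "Poly_Mapping.lookup (Poly_Mapping.single (nat_part x) k * f) (nat_part (x + y)) = 0"
    if xy: "nonneg (x + y)"
  proof (rule ccontr)
    assume "\<not> ?thesis"
    then have "nat_part (x + y) \<in> Poly_Mapping.keys (Poly_Mapping.single (nat_part x) k * f)"
      by (simp add: in_keys_iff)
    then obtain l where "nat_part (x + y) = nat_part x + l" by (rule keys_monomial_mult)
    then have "expo (nat_part (x + y)) = expo (nat_part x) + expo l" by (simp add: expo_add)
    then have eq: "Poly_Mapping.lookup (x + y) = Poly_Mapping.lookup x + expo l"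
      using xy x by (simp add: expo_nat_part)
    have "0 \<le> Poly_Mapping.lookup y v" for v
      using fun_cong[OF eq, of v] by (simp add: lookup_add expo_def)
    then show False using False by (simp add: nonneg_def)
  qed
  then show ?thesis using False x by (simp add: coeff_of_degree_def term_of_degree_def)
qed

lemma lookup_term_zero_degree: "Poly_Mapping.lookup (term_of_degree z k) 0 = (if z = 0 then k else 0)"
proof -
  have "nonneg z \<and> nat_part z = 0 \<longleftrightarrow> z = 0"
  proof
    assume z: "nonneg z \<and> nat_part z = 0"
    have "Poly_Mapping.lookup z = 0" using expo_nat_part[of z] z by simp
    then show "z = 0" by (auto intro: poly_mapping_eqI)
  qed simp
  then show ?thesis by (auto simp: term_of_degree_def lookup_single when_def)
qed

section \<open>The strands of a given resolution\<close>

locale graded_resolution =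
  fixes s :: "nat \<Rightarrow> ('n::finite \<Rightarrow>\<^sub>0 int) list"
    and D :: "nat \<Rightarrow> ('n, 'k::field) mpoly mat" and c :: "'k vec"
  assumes resolution: "graded_free_resolution_K s D c"
begin

definition N :: "nat \<Rightarrow> nat" where "N p = length (s p)"

definition \<sigma> :: "nat \<Rightarrow> nat \<Rightarrow> 'n \<Rightarrow> int" where "\<sigma> p q = Poly_Mapping.lookup (s p ! q)"

definition \<delta> :: "nat \<Rightarrow> nat \<Rightarrow> nat \<Rightarrow> 'k" where
  "\<delta> p q r = coeff_of_degree (s (Suc p) ! r - s p ! q) (D p $$ (q, r))"

sublocale multigraded_data N \<sigma> \<delta> .

definition to_vec :: "nat \<Rightarrow> ('n \<Rightarrow>\<^sub>0 int) \<Rightarrow> (nat \<Rightarrow> 'k) \<Rightarrow> ('n, 'k) mpoly vec" where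
  "to_vec p a f = vec (N p) (\<lambda>q. term_of_degree (a - s p ! q) (f q))"

text \<open>It applies to any vector and reads off the part of degree a. Exactness supplies
  preimages without homogeneity, and this projection, which commutes with the differential, makes
  them usable.\<close>

definition coords :: "nat \<Rightarrow> ('n \<Rightarrow>\<^sub>0 int) \<Rightarrow> ('n, 'k) mpoly vec \<Rightarrow> nat \<Rightarrow> 'k" where
  "coords p a w = (\<lambda>q. if q < N p then coeff_of_degree (a - s p ! q) (w $ q) else 0)"

lemma D_carrier: "D p \<in> carrier_mat (N p) (N (Suc p))"
  using resolution by (simp add: graded_free_resolution_K_def N_def)

lemma D_entry:
  assumes "q < N p" "r < N (Suc p)"
  shows "D p $$ (q, r) = term_of_degree (s (Suc p) ! r - s p ! q) (\<delta> p q r)"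
  unfolding \<delta>_def using assms resolution
  by (intro homogeneousD) (simp add: graded_free_resolution_K_def N_def)

lemma \<delta>_nonneg: "\<delta> p q r \<noteq> 0 \<Longrightarrow> nonneg (s (Suc p) ! r - s p ! q)"
  by (auto simp: \<delta>_def coeff_of_degree_def split: if_splits)

lemma D_mult_vec:
  assumes "w \<in> carrier_vec (N (Suc p))" "q < N p"
  shows "(D p *\<^sub>v w) $ q = (\<Sum>r<N (Suc p). D p $$ (q, r) * w $ r)"
  using assms D_carrier[of p]
  by (auto simp: scalar_prod_def atLeast0LessThan intro!: sum.cong)

lemma to_vec_carrier [simp]: "to_vec p a f \<in> carrier_vec (N p)"
  by (simp add: to_vec_def)

text \<open>The support condition excludes coefficients on basis elements without a monomial in
  degree a: \<open>to_vec\<close> drops them, whereas \<open>diff\<close> would still count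
  them.\<close>

lemma D_to_vec:
  assumes "f \<in> chain (Suc p) {t. t \<le> Poly_Mapping.lookup a}"
  shows "D p *\<^sub>v to_vec (Suc p) a f = to_vec p a (diff p f)"
proof (rule eq_vecI)
  show "dim_vec (D p *\<^sub>v to_vec (Suc p) a f) = dim_vec (to_vec p a (diff p f))"
    using D_carrier[of p] by (simp add: to_vec_def)
  fix q assume "q < dim_vec (to_vec p a (diff p f))"
  then have q: "q < N p" by (simp add: to_vec_def)
  have "D p $$ (q, r) * to_vec (Suc p) a f $ r = term_of_degree (a - s p ! q) (\<delta> p q r * f r)"
    if r: "r < N (Suc p)" for r
  proof (cases "\<delta> p q r * f r = 0")
    case True
    then show ?thesis using D_entry[OF q r] r by (auto simp: to_vec_def)
  next
    case False
    then have "nonneg (s (Suc p) ! r - s p ! q)" using \<delta>_nonneg by auto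
    moreover have "nonneg (a - s (Suc p) ! r)"
      using False assms by (auto simp: nonneg_diff_iff chain_def \<sigma>_def)
    ultimately have "term_of_degree (s (Suc p) ! r - s p ! q) (\<delta> p q r) * term_of_degree (a - s (Suc p) ! r) (f r)
        = term_of_degree ((s (Suc p) ! r - s p ! q) + (a - s (Suc p) ! r)) (\<delta> p q r * f r)"
      by (rule term_mult_term)
    then show ?thesis using D_entry[OF q r] r by (simp add: to_vec_def)
  qed
  then show "(D p *\<^sub>v to_vec (Suc p) a f) $ q = to_vec p a (diff p f) $ q"
    using D_mult_vec[OF to_vec_carrier q] q by (simp add: to_vec_def diff_def term_sum)
qed

lemma coords_D:
  assumes "w \<in> carrier_vec (N (Suc p))"
  shows "coords p a (D p *\<^sub>v w) = diff p (coords (Suc p) a w)"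
proof
  fix q
  show "coords p a (D p *\<^sub>v w) q = diff p (coords (Suc p) a w) q"
  proof (cases "q < N p")
    case True
    have "coeff_of_degree (a - s p ! q) (D p $$ (q, r) * w $ r)
        = \<delta> p q r * coeff_of_degree (a - s (Suc p) ! r) (w $ r)" if r: "r < N (Suc p)" for r
    proof (cases "\<delta> p q r = 0")
      case False
      have eq: "a - s p ! q = (s (Suc p) ! r - s p ! q) + (a - s (Suc p) ! r)" by simp
      show ?thesis
        unfolding D_entry[OF True r] eq by (rule coeff_term_mult[OF \<delta>_nonneg[OF False]])
    qed (simp add: D_entry[OF True r])
    then show ?thesis
      using True D_mult_vec[OF assms True] by (simp add: coords_def diff_def coeff_sum)
  qed (simp add: coords_def diff_def)
qed

lemma coords_to_vec:
  assumes "f \<in> chain p {t. t \<le> Poly_Mapping.lookup a}" shows "coords p a (to_vec p a f) = f"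
proof
  fix q
  have "f q \<noteq> 0 \<longrightarrow> q < N p \<and> nonneg (a - s p ! q)"
    using assms by (auto simp: chain_def \<sigma>_def nonneg_diff_iff)
  then show "coords p a (to_vec p a f) q = f q"
    by (auto simp: coords_def to_vec_def coeff_term)
qed

lemma coords_chain: "coords p a w \<in> chain p {t. t \<le> Poly_Mapping.lookup a}"
  by (auto simp: coords_def chain_def coeff_of_degree_def \<sigma>_def nonneg_diff_iff split: if_splits)

text \<open>The principal case of \<open>diff_chain\<close>, derived from
  \<open>\<delta>_nonneg\<close> because the interpretation as \<open>multigraded_complex\<close>
  depends on it.\<close>

lemma diff_chain_le:
  assumes "f \<in> chain (Suc p) {t. t \<le> b}" shows "diff p f \<in> chain p {t. t \<le> b}"
  unfolding chain_def
proof (intro CollectI allI impI)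
  fix q assume nz: "diff p f q \<noteq> 0"
  then have q: "q < N p" by (auto simp: diff_def split: if_splits)
  then have "(\<Sum>r<N (Suc p). \<delta> p q r * f r) \<noteq> 0" using nz by (simp add: diff_def)
  then obtain r where r: "\<delta> p q r * f r \<noteq> 0" by (meson sum.neutral)
  then have "\<sigma> p q \<le> \<sigma> (Suc p) r" using \<delta>_nonneg[of p q r] by (simp add: nonneg_diff_iff \<sigma>_def)
  moreover have "\<sigma> (Suc p) r \<le> b" using r assms by (auto simp: chain_def)
  ultimately show "q < N p \<and> \<sigma> p q \<in> {t. t \<le> b}" using q by (auto intro: order_trans)
qed

lemma to_vec_eq_0_iff:
  assumes "f \<in> chain p {t. t \<le> Poly_Mapping.lookup a}"
  shows "to_vec p a f = 0\<^sub>v (N p) \<longleftrightarrow> f = 0"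
proof
  assume "to_vec p a f = 0\<^sub>v (N p)"
  then have "f = coords p a (0\<^sub>v (N p))" using coords_to_vec[OF assms] by metis
  then show "f = 0" by (auto simp: coords_def)
qed (auto simp: to_vec_def)

lemma to_vec_kernel_iff:
  assumes "f \<in> chain (Suc p) {t. t \<le> Poly_Mapping.lookup a}"
  shows "to_vec (Suc p) a f \<in> mat_kernel (D p) \<longleftrightarrow> diff p f = 0"
  using D_carrier[of p] to_vec_eq_0_iff[OF diff_chain_le[OF assms]]
  by (simp add: mat_kernel_def D_to_vec[OF assms])

lemma kernel_eq_image: "mat_kernel (D p) = (\<lambda>w. D (Suc p) *\<^sub>v w) ` carrier_vec (N (Suc (Suc p)))"
  using resolution by (simp add: graded_free_resolution_K_def N_def)

lemma augmentation_kernel: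
  "{v \<in> carrier_vec (N 0). augmentation c v = 0} = (\<lambda>w. D 0 *\<^sub>v w) ` carrier_vec (N 1)"
  using resolution by (simp add: graded_free_resolution_K_def N_def)

lemma augmentation_to_vec:
  "augmentation c (to_vec 0 a f) = (\<Sum>q<N 0. if a = 0 then c $ q * f q else 0)"
proof -
  have "c $ q * Poly_Mapping.lookup (to_vec 0 a f $ q) 0 = (if a = 0 then c $ q * f q else 0)"
    if "q < N 0" for q
  proof (cases "c $ q = 0")
    case False
    then have "s 0 ! q = 0" using that resolution by (simp add: graded_free_resolution_K_def N_def)
    then show ?thesis using that by (simp add: to_vec_def lookup_term_zero_degree)
  qed simp
  then show ?thesis by (simp add: augmentation_def to_vec_def)
qed

lemma diff_diff_le:
  assumes "f \<in> chain (Suc (Suc p)) {t. t \<le> Poly_Mapping.lookup a}"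
  shows "diff p (diff (Suc p) f) = 0"
proof -
  have "to_vec (Suc p) a (diff (Suc p) f) \<in> mat_kernel (D p)"
    unfolding kernel_eq_image D_to_vec[OF assms, symmetric] by (intro imageI) simp
  then show ?thesis using to_vec_kernel_iff[OF diff_chain_le[OF assms]] by simp
qed

text \<open>The ranks are finite, so all chains of one index lie in a single strand; facts known for
  strands thereby hold for arbitrary f.\<close>

lemma degree_bound: "\<exists>a. \<forall>r<N p. \<sigma> p r \<le> Poly_Mapping.lookup a"
proof
  let ?a = "Abs_poly_mapping (\<lambda>v. \<Sum>r<N p. \<bar>\<sigma> p r v\<bar>) :: 'n \<Rightarrow>\<^sub>0 int"
  show "\<forall>r<N p. \<sigma> p r \<le> Poly_Mapping.lookup ?a"
  proof (intro allI impI le_funI)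
    fix r v assume "r < N p"
    then have "\<bar>\<sigma> p r v\<bar> \<le> (\<Sum>r<N p. \<bar>\<sigma> p r v\<bar>)" by (intro member_le_sum) auto
    then show "\<sigma> p r v \<le> Poly_Mapping.lookup ?a v" by simp
  qed
qed

text \<open>In positive index a preimage from exactness is cut down to degree a by
  \<open>coords\<close>. In index 0 the augmentation vanishes on strands with
  \<open>a \<noteq> 0\<close>; for a = 0, the degree 0 part of an element of augmentation 1 is no
  boundary.\<close>

lemma principal_homology:
  "homology_nz i {t. t \<le> Poly_Mapping.lookup a} \<longleftrightarrow> i = 0 \<and> a = 0"
proof (cases i)
  case (Suc p)
  have "z \<in> diff i ` chain (Suc i) {t. t \<le> Poly_Mapping.lookup a}"
    if "z \<in> cycle i {t. t \<le> Poly_Mapping.lookup a}" for z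
  proof -
    have z: "z \<in> chain (Suc p) {t. t \<le> Poly_Mapping.lookup a}" "diff p z = 0"
      using that by (auto simp: cycle_def Suc)
    then have "to_vec (Suc p) a z \<in> mat_kernel (D p)" using to_vec_kernel_iff by blast
    then obtain w where w: "w \<in> carrier_vec (N (Suc i))" "to_vec i a z = D i *\<^sub>v w"
      unfolding kernel_eq_image Suc by blast
    have "z = diff i (coords (Suc i) a w)"
      using coords_D[OF w(1), of a] coords_to_vec[OF z(1)] w(2) by (simp add: Suc)
    then show ?thesis using coords_chain by blast
  qed
  then show ?thesis by (auto simp: homology_nz_def Suc)
next
  case 0
  have aug: "augmentation c (to_vec 0 a (diff 0 f)) = 0"
    if "f \<in> chain 1 {t. t \<le> Poly_Mapping.lookup a}" for f
  proof -
    have f: "f \<in> chain (Suc 0) {t. t \<le> Poly_Mapping.lookup a}" using that by simp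
    have "to_vec 0 a (diff 0 f) \<in> (\<lambda>w. D 0 *\<^sub>v w) ` carrier_vec (N 1)"
      unfolding D_to_vec[OF f, symmetric] by (intro imageI) simp
    then show ?thesis unfolding augmentation_kernel[symmetric] by simp
  qed
  show ?thesis
  proof (cases "a = 0")
    case True
    have "1 \<in> augmentation c ` (carrier_vec (N 0) :: ('n, 'k) mpoly vec set)"
      using resolution by (simp add: graded_free_resolution_K_def N_def)
    then obtain w :: "('n, 'k) mpoly vec" where w: "w \<in> carrier_vec (N 0)" "augmentation c w = 1"
      by (metis imageE)
    define z where "z = coords 0 0 w"
    have "augmentation c (to_vec 0 0 z) = (\<Sum>q<N 0. c $ q * z q)" by (simp add: augmentation_to_vec)
    also have "\<dots> = (\<Sum>q<N 0. c $ q * Poly_Mapping.lookup (w $ q) 0)"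
    proof (rule sum.cong[OF refl])
      fix q assume "q \<in> {..<N 0}"
      then have q: "q < N 0" by simp
      show "c $ q * z q = c $ q * Poly_Mapping.lookup (w $ q) 0"
      proof (cases "c $ q = 0")
        case False
        then have "s 0 ! q = 0" using q resolution by (simp add: graded_free_resolution_K_def N_def)
        then show ?thesis using q by (simp add: z_def coords_def coeff_of_degree_def)
      qed simp
    qed
    also have "\<dots> = 1" using w by (simp add: augmentation_def)
    finally have "z \<notin> diff 0 ` chain 1 {t. t \<le> Poly_Mapping.lookup a}"
      using aug by (auto simp: True)
    moreover have "z \<in> chain 0 {t. t \<le> Poly_Mapping.lookup a}"
      unfolding z_def True by (rule coords_chain)
    ultimately show ?thesis using 0 True by (auto simp: homology_nz_def cycle_def)
  next
    case False
    have "z \<in> diff 0 ` chain 1 {t. t \<le> Poly_Mapping.lookup a}"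
      if z: "z \<in> chain 0 {t. t \<le> Poly_Mapping.lookup a}" for z
    proof -
      have "augmentation c (to_vec 0 a z) = 0" using False by (simp add: augmentation_to_vec)
      then have "to_vec 0 a z \<in> (\<lambda>w. D 0 *\<^sub>v w) ` carrier_vec (N 1)"
        unfolding augmentation_kernel[symmetric] by simp
      then obtain w where w: "w \<in> carrier_vec (N (Suc 0))" "to_vec 0 a z = D 0 *\<^sub>v w" by auto
      have "z = diff 0 (coords (Suc 0) a w)"
        using coords_D[OF w(1), of a] coords_to_vec[OF z] w(2) by simp
      then show ?thesis using coords_chain[of "Suc 0" a w] by auto
    qed
    then show ?thesis using 0 False by (auto simp: homology_nz_def cycle_def)
  qed
qed

sublocale multigraded_complex N \<sigma> \<delta>
proof
  show "\<sigma> p q \<le> \<sigma> (Suc p) r" if "\<delta> p q r \<noteq> 0" for p q r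
    using \<delta>_nonneg[OF that] by (simp add: nonneg_diff_iff \<sigma>_def)
  show "diff p (diff (Suc p) f) = 0" for p f
  proof -
    obtain a where a: "\<And>r. r < N (Suc (Suc p)) \<Longrightarrow> \<sigma> (Suc (Suc p)) r \<le> Poly_Mapping.lookup a"
      using degree_bound by blast
    define g where "g = (\<lambda>r. if r < N (Suc (Suc p)) then f r else 0)"
    have "g \<in> chain (Suc (Suc p)) {t. t \<le> Poly_Mapping.lookup a}"
      using a by (auto simp: chain_def g_def)
    moreover have "diff (Suc p) f = diff (Suc p) g" by (auto simp: diff_def g_def intro!: sum.cong)
    ultimately show ?thesis using diff_diff_le by metis
  qed
  show "homology_nz i {t. t \<le> b} \<longleftrightarrow> i = 0 \<and> b = 0" for i b
  proof -
    define a :: "'n \<Rightarrow>\<^sub>0 int" where "a = Abs_poly_mapping b"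
    have b: "b = Poly_Mapping.lookup a" by (simp add: a_def)
    have "b = 0 \<longleftrightarrow> a = 0" unfolding b by (auto simp: fun_eq_iff intro: poly_mapping_eqI)
    then show ?thesis using principal_homology[of i a] by (simp add: b)
  qed
qed

section \<open>Tensoring the resolution with a monomial ideal\<close>

context
  fixes M :: "('n \<Rightarrow> int) set" and a :: "'n \<Rightarrow>\<^sub>0 int"
  assumes M_nonneg: "\<And>m. m \<in> M \<Longrightarrow> 0 \<le> m" and M_up: "\<And>m m'. m \<in> M \<Longrightarrow> m \<le> m' \<Longrightarrow> m' \<in> M"
begin

abbreviation U where "U \<equiv> {t. Poly_Mapping.lookup a - t \<in> M}"

lemma chain_U: "f \<in> chain p U \<Longrightarrow> f \<in> chain p {t. t \<le> Poly_Mapping.lookup a}"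
  by (erule chain_mono) (use M_nonneg in \<open>force simp: le_fun_def\<close>)

lemma tensor_ideal_component_eq:
  "tensor_ideal_component (s p) (mon_ideal M) a = to_vec p a ` chain p U"
proof
  show "tensor_ideal_component (s p) (mon_ideal M) a \<subseteq> to_vec p a ` chain p U"
  proof
    fix w :: "('n, 'k) mpoly vec" assume "w \<in> tensor_ideal_component (s p) (mon_ideal M) a"
    then have w: "w \<in> carrier_vec (N p)" "\<And>q. q < N p \<Longrightarrow> w $ q \<in> mon_ideal M"
      "\<And>q. q < N p \<Longrightarrow> homogeneous (a - s p ! q) (w $ q)"
      by (auto simp: tensor_ideal_component_def N_def)
    have "w = to_vec p a (coords p a w)"
    proof (rule eq_vecI)
      fix q assume "q < dim_vec (to_vec p a (coords p a w))"
      then have "q < N p" by (simp add: to_vec_def)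
      then show "w $ q = to_vec p a (coords p a w) $ q"
        using homogeneousD[OF w(3)] by (simp add: to_vec_def coords_def)
    qed (use w in \<open>simp add: to_vec_def\<close>)
    moreover have "coords p a w \<in> chain p U"
      unfolding chain_def
    proof (intro CollectI allI impI)
      fix q assume nz: "coords p a w q \<noteq> 0"
      then have q: "q < N p" by (auto simp: coords_def split: if_splits)
      then have "nonneg (a - s p ! q)" "nat_part (a - s p ! q) \<in> Poly_Mapping.keys (w $ q)"
        using nz by (auto simp: coords_def coeff_of_degree_def in_keys_iff split: if_splits)
      then have "Poly_Mapping.lookup (a - s p ! q) \<in> M"
        using w(2)[OF q] expo_nat_part by (fastforce simp: mon_ideal_def)
      moreover have "Poly_Mapping.lookup (a - s p ! q) = Poly_Mapping.lookup a - \<sigma> p q"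
        by (auto simp: lookup_minus \<sigma>_def)
      ultimately show "q < N p \<and> \<sigma> p q \<in> U" using q by simp
    qed
    ultimately show "w \<in> to_vec p a ` chain p U" by blast
  qed
  show "to_vec p a ` chain p U \<subseteq> tensor_ideal_component (s p) (mon_ideal M) a"
  proof
    fix w assume "w \<in> to_vec p a ` chain p U"
    then obtain f where f: "f \<in> chain p U" "w = to_vec p a f" by blast
    have "term_of_degree (a - s p ! q) (f q) \<in> mon_ideal M" if "q < N p" for q
    proof (cases "f q = 0")
      case False
      then have "Poly_Mapping.lookup a - \<sigma> p q \<in> M" using f(1) by (auto simp: chain_def)
      moreover have "Poly_Mapping.lookup (a - s p ! q) = Poly_Mapping.lookup a - \<sigma> p q"
        by (auto simp: lookup_minus \<sigma>_def)
      ultimately show ?thesis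
        by (auto simp: mon_ideal_def term_of_degree_def expo_nat_part)
    qed (simp add: mon_ideal_def)
    then show "w \<in> tensor_ideal_component (s p) (mon_ideal M) a"
      by (simp add: tensor_ideal_component_def f(2) to_vec_def N_def homogeneous_term)
  qed
qed

text \<open>\<open>to_vec\<close> is injective on chains and boundaries are cycles, so the two sets
  differ exactly when some cycle is not a boundary.\<close>

lemma Tor_iff: "Tor_cycles s D i (mon_ideal M) a \<noteq> Tor_boundaries s D i (mon_ideal M) a \<longleftrightarrow> homology_nz i U"
proof -
  have cyc: "Tor_cycles s D i (mon_ideal M) a = to_vec i a ` cycle i U"
  proof (cases i)
    case 0
    then show ?thesis by (simp add: Tor_cycles_def cycle_def tensor_ideal_component_eq)
  next
    case (Suc p)
    show ?thesis
      using to_vec_kernel_iff[OF chain_U]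
      by (auto simp: Tor_cycles_def cycle_def tensor_ideal_component_eq Suc)
  qed
  have bd: "Tor_boundaries s D i (mon_ideal M) a = to_vec i a ` diff i ` chain (Suc i) U"
    unfolding Tor_boundaries_def tensor_ideal_component_eq image_image
    by (intro image_cong refl D_to_vec chain_U)
  have down: "downset U" by (rule downset_upset) (rule M_up)
  have sub: "diff i ` chain (Suc i) U \<subseteq> cycle i U"
    using diff_cycle diff_chain[OF down] by blast
  have "inj_on (to_vec i a) (chain i U)"
    by (rule inj_on_inverseI[where g = "coords i a"]) (rule coords_to_vec[OF chain_U])
  then have "inj_on (to_vec i a) (cycle i U)" by (rule inj_on_subset) (auto simp: cycle_def)
  then have "to_vec i a ` cycle i U = to_vec i a ` diff i ` chain (Suc i) U
      \<longleftrightarrow> cycle i U = diff i ` chain (Suc i) U"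
    using inj_on_image_eq_iff sub by blast
  then show ?thesis unfolding cyc bd homology_nz_def using sub by blast
qed

end

end

text \<open>The criterion \<open>hs_set\<close> does not mention the resolution, so all resolutions
  give the same answer. One must be supplied because \<open>Tor_nonzero\<close> asserts that a
  resolution exists.\<close>

lemma Tor_nonzero_iff:
  fixes s0 :: "nat \<Rightarrow> ('n::finite \<Rightarrow>\<^sub>0 int) list" and D0 :: "nat \<Rightarrow> ('n, 'k::field) mpoly mat"
  assumes "m_convex B d" "\<forall>b\<in>B. 0 \<le> b" "graded_free_resolution_K s0 D0 c0"
  shows "Tor_nonzero i (mon_ideal (upset B) :: ('n, 'k) mpoly set) a \<longleftrightarrow> Poly_Mapping.lookup a \<in> hs_set i B"
proof -
  have iff: "Tor_cycles s D i (mon_ideal (upset B)) a \<noteq> Tor_boundaries s D i (mon_ideal (upset B)) a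
      \<longleftrightarrow> Poly_Mapping.lookup a \<in> hs_set i B"
    if "graded_free_resolution_K s D c" for s and D :: "nat \<Rightarrow> ('n, 'k) mpoly mat" and c
  proof -
    interpret graded_resolution s D c by unfold_locales (rule that)
    interpret m_convex B d by (rule assms)
    interpret m_convex_complex B d N \<sigma> \<delta> ..
    have "0 \<le> m" if "m \<in> upset B" for m
      using that assms(2) unfolding upset_def above_def by (blast intro: order_trans)
    from Tor_iff[OF this upset_up, of B] show ?thesis
      using tor_iff_hs_set[of i "Poly_Mapping.lookup a"] by (simp add: tor_nz_def upset_def)
  qed
  then show ?thesis unfolding Tor_nonzero_def using assms(3) by metis
qed

section \<open>Socle elements\<close>

lemma hs_set_nonneg:
  assumes "\<forall>b\<in>B. 0 \<le> b" "a \<in> hs_set i B" shows "0 \<le> a"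
proof (rule le_funI)
  fix x
  obtain F where "(\<lambda>y. a y - of_bool (y \<in> F)) \<in> B" using assms(2) by (auto simp: hs_set_def)
  then have "0 \<le> (\<lambda>y. a y - of_bool (y \<in> F))" using assms(1) by blast
  from le_funD[OF this, of x] show "0 x \<le> a x" by (simp add: of_bool_def split: if_splits)
qed

text \<open>Translation by b keeps every F as a witness, so the index i is unchanged.\<close>

lemma hs_set_add:
  assumes "b \<in> B" "a \<in> hs_set i C" shows "b + a \<in> hs_set i {b + c | b c. b \<in> B \<and> c \<in> C}"
  unfolding hs_set_def
proof (intro CollectI allI)
  fix v
  obtain F where F: "card F = i" "v \<notin> F" "(\<lambda>x. a x - of_bool (x \<in> F)) \<in> C"
    using assms(2) by (auto simp: hs_set_def)
  have "(\<lambda>x. (b + a) x - of_bool (x \<in> F)) = b + (\<lambda>x. a x - of_bool (x \<in> F))" by auto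
  then show "\<exists>F. card F = i \<and> v \<notin> F \<and> (\<lambda>x. (b + a) x - of_bool (x \<in> F)) \<in> {b + c | b c. b \<in> B \<and> c \<in> C}"
    using F assms(1) by blast
qed

text \<open>For each x some \<alpha> x in A lies below \<open>u + ind {x}\<close> but not below u,
  so it attains \<open>u x + 1\<close> at x. Removing one unit at a fixed v from \<alpha> v gives w;
  exchange against \<alpha> x moves that unit to x. The equation \<open>w v = u v\<close> later
  secures nonnegativity of w at v.\<close>

lemma socle_in_generator_degree:
  assumes "exchange A" "u \<notin> upset A" "\<And>v. u + ind {v} \<in> upset A"
  obtains w v where "\<And>x. w + ind {x} \<in> A" "w v = u v"
proof -
  have "\<exists>a\<in>A. a \<le> u + ind {x} \<and> a x = u x + 1" for x
  proof -
    obtain a where a: "a \<in> A" "a \<le> u + ind {x}" using assms(3)[of x] by (auto simp: upset_def above_def)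
    have le: "a y \<le> u y + of_bool (y = x)" for y using le_funD[OF a(2), of y] by (simp add: ind_def)
    have "\<not> a \<le> u" using assms(2) a(1) by (auto simp: upset_def above_def)
    then obtain y where "u y < a y" by (auto simp: le_fun_def not_le)
    then have "a x = u x + 1" using le[of y] by (cases "y = x") auto
    then show ?thesis using a by blast
  qed
  then obtain \<alpha> where \<alpha>: "\<And>x. \<alpha> x \<in> A" "\<And>x. \<alpha> x \<le> u + ind {x}" "\<And>x. \<alpha> x x = u x + 1" by metis
  have le: "\<alpha> x y \<le> u y + of_bool (y = x)" for x y using le_funD[OF \<alpha>(2), of x y] by (simp add: ind_def)
  fix v
  define w where "w = \<alpha> v - ind {v}"
  have "w + ind {x} \<in> A" for x
  proof (cases "x = v")
    case True
    then show ?thesis using \<alpha>(1) by (simp add: w_def)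
  next
    case False
    have "\<alpha> x v < \<alpha> v v" using le[of x v] False by (simp add: \<alpha>(3))
    then obtain j where j: "\<alpha> v j < \<alpha> x j" "swap v j (\<alpha> v) \<in> A" using exchangeE[OF assms(1) \<alpha>(1) \<alpha>(1)] by blast
    \<comment> \<open>Any other j would give an element of A below u: the excess of \<alpha> v at v
      is gone, and the new unit at j stays within \<open>\<alpha> x j\<close>, which is at most u
      j.\<close>
    have "j = x"
    proof (rule ccontr)
      assume "j \<noteq> x"
      have "swap v j (\<alpha> v) y \<le> u y" for y
        using le[of v y] le[of x j] \<open>j \<noteq> x\<close> j(1) \<alpha>(3)[of v] by (auto simp: swap_def of_bool_def split: if_splits)
      then have "swap v j (\<alpha> v) \<le> u" by (rule le_funI)
      then show False using j(2) assms(2) by (auto simp: upset_def above_def)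
    qed
    moreover have "swap v x (\<alpha> v) = w + ind {x}" by (auto simp: swap_def w_def ind_def)
    ultimately show ?thesis using j(2) by simp
  qed
  moreover have "w v = u v" using \<alpha>(3)[of v] by (simp add: w_def ind_def)
  ultimately show thesis by (rule that)
qed

lemma HS_eq:
  assumes "m_convex B d" "\<forall>b\<in>B. 0 \<le> b"
    and "graded_free_resolution_K s (D :: nat \<Rightarrow> ('n::finite, 'k::field) mpoly mat) c"
  shows "HS i (mon_ideal (upset B) :: ('n, 'k) mpoly set) = mon_ideal (upset (hs_set i B))"
proof -
  have "expo ` {a. expo a \<in> hs_set i B} = hs_set i B"
  proof (intro equalityI subsetI)
    fix a assume a: "a \<in> hs_set i B"
    obtain k where "expo k = a" using expo_surj[OF hs_set_nonneg[OF assms(2) a]] .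
    then show "a \<in> expo ` {a. expo a \<in> hs_set i B}" using a by blast
  qed blast
  then show ?thesis
    unfolding HS_def ideal_gen_monomials Tor_nonzero_iff[OF assms] lookup_multideg by simp
qed

lemma polymatroidalE:
  fixes I :: "('n::finite, 'k::field) mpoly set"
  assumes "polymatroidal I"
  obtains A d where "I = ideal_gen (monomial ` A)" "m_convex (expo ` A) d"
proof -
  obtain A where I: "min_monomial_gens I A" "I \<noteq> {0}"
    and deg: "\<forall>u\<in>A. \<forall>w\<in>A. total_deg u = total_deg w"
    and ex: "\<forall>u\<in>A. \<forall>w\<in>A. \<forall>i. Poly_Mapping.lookup u i > Poly_Mapping.lookup w i \<longrightarrow>
      (\<exists>j. Poly_Mapping.lookup u j < Poly_Mapping.lookup w j \<and>
        (u - Poly_Mapping.single i 1) + Poly_Mapping.single j 1 \<in> A)"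
    using assms unfolding polymatroidal_def by (elim exE conjE)
  have I_gen: "I = ideal_gen (monomial ` A)" using I(1) by (simp add: min_monomial_gens_def)
  have "A \<noteq> {}"
  proof
    assume "A = {}"
    then have "I = mon_ideal (upset {})" using ideal_gen_monomials[of "{}"] by (simp add: I_gen)
    then show False using I(2) by (auto simp: mon_ideal_def upset_def)
  qed
  then obtain a where a: "a \<in> A" by blast
  define d where "d = int (total_deg a)"
  have sum_expo: "sum (expo b) UNIV = d" if "b \<in> A" for b
  proof -
    have "sum (expo b) UNIV = int (total_deg b)" by (simp add: total_deg_def expo_def)
    moreover have "total_deg b = total_deg a" using deg that a by blast
    ultimately show ?thesis by (simp add: d_def)
  qed
  have "m_convex (expo ` A) d"
  proof
    \<comment> \<open>Generators of common degree d have all exponents between 0 and d, which gives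
      finiteness.\<close>
    have "expo ` A \<subseteq> PiE UNIV (\<lambda>_. {0..d})"
    proof safe
      fix b v assume "b \<in> A"
      have "expo b v \<le> sum (expo b) UNIV" by (intro member_le_sum) (auto simp: expo_def)
      then show "expo b v \<in> {0..d}" using sum_expo[OF \<open>b \<in> A\<close>] by (simp add: expo_def)
    qed simp
    then show "finite (expo ` A)" by (rule finite_subset) (intro finite_PiE; simp)
    show "expo ` A \<noteq> {}" using a by blast
    show "sum b UNIV = d" if "b \<in> expo ` A" for b using that sum_expo by blast
    show "exchange (expo ` A)"
      unfolding exchange_def
    proof (intro ballI allI impI)
      fix b c v assume "b \<in> expo ` A" "c \<in> expo ` A" and v: "c v < b v"
      then obtain u w where u: "u \<in> A" "b = expo u" and w: "w \<in> A" "c = expo w" by blast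
      have "Poly_Mapping.lookup w v < Poly_Mapping.lookup u v" using v by (simp add: u w expo_def)
      then obtain j where j: "Poly_Mapping.lookup u j < Poly_Mapping.lookup w j"
        "(u - Poly_Mapping.single v 1) + Poly_Mapping.single j 1 \<in> A" using ex u(1) w(1) by blast
      \<comment> \<open>The truncated subtraction is exact here, as u has a positive exponent at
        v.\<close>
      have "swap v j b = expo ((u - Poly_Mapping.single v 1) + Poly_Mapping.single j 1)"
        using v by (auto simp: swap_def u w expo_def lookup_add lookup_minus lookup_single when_def fun_eq_iff of_nat_diff)
      then show "\<exists>j. b j < c j \<and> swap v j b \<in> expo ` A"
        using j by (intro exI[of _ j]) (auto simp: u w expo_def)
    qed
  qed
  then show thesis using that I_gen by blast
qed

theorem corollary6p4:
  fixes I :: "('n::finite, 'k::field) mpoly set" and i k0 :: nat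
  assumes "polymatroidal I"
    and "k0 > 0"
    and "graded_max_ideal \<in> Ass (HS i (ideal_power I k0))"
  shows "\<forall>k\<ge>k0. graded_max_ideal \<in> Ass (HS i (ideal_power I k))"
proof -
  obtain A d where I: "I = ideal_gen (monomial ` A)" and "m_convex (expo ` A) d"
    using polymatroidalE[OF assms(1)] by blast
  define B where "B k = sumpow k (expo ` A)" for k
  have B: "m_convex (B k) (int k * d)" for k
    unfolding B_def by (rule m_convex_sumpow) fact
  have B_nonneg: "\<forall>b\<in>B k. 0 \<le> b" for k
    by (simp add: B_def expo_nonneg flip: expo_sumpow)
  have power: "ideal_power I k = mon_ideal (upset (B k))" for k
    using ideal_power_monomials[of A k] ideal_gen_monomials[of "sumpow k A"]
    unfolding I B_def expo_sumpow by (rule trans)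
  \<comment> \<open>This uses only the definition of HS: its description by \<open>hs_set\<close>
    needs a resolution, which is extracted from this very statement.\<close>
  obtain u where u: "0 \<le> u" "u \<notin> upset (expo ` {a. Tor_nonzero i (ideal_power I k0) (multideg a)})"
    "\<And>v. u + ind {v} \<in> upset (expo ` {a. Tor_nonzero i (ideal_power I k0) (multideg a)})"
    using assms(3) unfolding HS_def ideal_gen_monomials Ass_mon_ideal_iff by blast
  \<comment> \<open>Some Tor module is nonzero, so a resolution of K of the required form exists.\<close>
  have "{a. Tor_nonzero i (ideal_power I k0) (multideg a)} \<noteq> {}"
    using u(3)[of undefined] by (auto simp: upset_def)
  then obtain s and D :: "nat \<Rightarrow> ('n, 'k) mpoly mat" and c where res: "graded_free_resolution_K s D c"
    unfolding Tor_nonzero_def by blast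
  have HS: "HS i (ideal_power I k) = mon_ideal (upset (hs_set i (B k)))" for k
    unfolding power by (rule HS_eq[OF B B_nonneg res])
  define socle where "socle k w \<longleftrightarrow> 0 \<le> w \<and> (\<forall>v. w + ind {v} \<in> hs_set i (B k))" for k w
  have Ass: "graded_max_ideal \<in> Ass (HS i (ideal_power I k))" if w: "socle k w" for k w
  proof -
    \<comment> \<open>All elements of \<open>hs_set i (B k)\<close> share one total degree, which is
      1 more than that of w, so none lies below w. Below, \<open>undefined\<close> is an arbitrary
      variable.\<close>
    have deg: "sum a UNIV = int k * d + int i" if "a \<in> hs_set i (B k)" for a
      using that by (simp add: m_convex.hs_set_iff[OF B])
    have "w \<notin> upset (hs_set i (B k))"
    proof
      assume "w \<in> upset (hs_set i (B k))"
      then obtain a where a: "a \<in> hs_set i (B k)" "a \<le> w" by (auto simp: upset_def above_def)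
      have "sum a UNIV \<le> sum w UNIV" by (rule sum_mono) (rule le_funD[OF a(2)])
      moreover have "w + ind {undefined} \<in> hs_set i (B k)" using w by (simp add: socle_def)
      ultimately show False using deg[OF a(1)] deg[of "w + ind {undefined}"] by simp
    qed
    moreover have "w + ind {v} \<in> upset (hs_set i (B k))" for v
      using w by (auto simp: socle_def upset_def above_def)
    ultimately show ?thesis
      unfolding HS Ass_mon_ideal_iff using w by (auto simp: socle_def)
  qed
  have "\<exists>w. socle k w" if "k \<ge> k0" for k
    using that
  proof (induction k rule: dec_induct)
    case base
    obtain u where u: "0 \<le> u" "u \<notin> upset (hs_set i (B k0))" "\<And>v. u + ind {v} \<in> upset (hs_set i (B k0))"
      using assms(3) unfolding HS Ass_mon_ideal_iff by blast
    obtain w v where w: "\<And>x. w + ind {x} \<in> hs_set i (B k0)" "w v = u v"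
      using socle_in_generator_degree[OF m_convex.exchange_hs_set[OF B] u(2,3)] by blast
    \<comment> \<open>This gives nonnegativity of w away from v; at v it comes from
      \<open>w v = u v\<close>.\<close>
    have "0 \<le> w + ind {v}" using hs_set_nonneg[OF B_nonneg] w(1) by blast
    then have "0 \<le> w x" for x
      using u(1) w(2) by (cases "x = v") (auto simp: le_fun_def ind_def dest: spec[of _ x])
    then show ?case using w(1) by (auto simp: socle_def le_fun_def)
  next
    case (step k)
    then obtain w where w: "socle k w" by blast
    obtain b where b: "b \<in> expo ` A" using m_convex.nonempty[OF \<open>m_convex (expo ` A) d\<close>] by blast
    have "b + (w + ind {v}) \<in> hs_set i (B (Suc k))" for v
      using hs_set_add[OF b] w by (simp add: socle_def B_def)
    moreover have "0 \<le> b + w" using w b expo_nonneg by (auto simp: socle_def intro!: add_nonneg_nonneg)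
    ultimately have "socle (Suc k) (b + w)" by (simp add: socle_def add.assoc)
    then show ?case by blast
  qed
  then show ?thesis using Ass by blast
qed

end
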